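(* Let $\mathsf{A}$ be a nonempty compact subset of $\mathit{GL}_2^+(\mathbb{R})$. Suppose that $$\check{\varrho}(\mathsf{A}) > \check{\varrho}(\wedge^2 \mathsf{A})^{1/2}$$ and that $\mathsf{A}$ is not $1$-dominated. Then the function $\theta \in \mathbb{R} \mapsto \check{\varrho}(R_\theta \mathsf{A}) \in \mathbb{R}_+$ is discontinuous at $\theta = 0$.
   Context: $\mathit{GL}_2^+(\mathbb{R})$ is the set of real $2\times 2$ matrices with positive determinant. $R_\theta \in SO(2)$ is the anticlockwise rotation of the plane through angle $\theta$, and $R_\theta\mathsf{A} := \{R_\theta A : A \in \mathsf{A}\}$. $\mathbb{R}_+=[0,\infty)$. For a nonempty compact set $\mathsf{S}$ of linear endomorphisms of a finite-dimensional real vector space, the lower spectral radius is $$\check{\varrho}(\mathsf{S}) := \lim_{n\to\infty} \inf\{\|A_n\cdots A_1\|^{1/n} : A_1,\dots,A_n \in \mathsf{S}\} = \inf_{n\ge 1} \inf\{\|A_n\cdots A_1\|^{1/n} : A_1,\dots,A_n \in \mathsf{S}\},$$ which does not depend on the operator norm used. $\wedge^k A$ denotes the $k$th exterior power of $A$ and $\wedge^k\mathsf{A} := \{\wedge^k A : A\in\mathsf{A}\}$. (Since $\wedge^2\mathbb{R}^2$ is one-dimensional, $\check{\varrho}(\wedge^2\mathsf{A})^{1/2} = \inf_{A\in\mathsf{A}} |\det A|^{1/2}$ for $\mathsf{A} \subset \mathit{GL}_2(\mathbb{R})$.) Let $\sigma_1(A)\ge \cdots \ge \sigma_d(A)$ denote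 the singular values of $A$. A nonempty compact set $\mathsf{A}\subset \mathit{GL}_d(\mathbb{R})$ is $k$-dominated, $1\le k<d$, if there exist constants $C>1$, $\tau\in(0,1)$ such that $\sigma_{k+1}(A_n\cdots A_1)/\sigma_k(A_n\cdots A_1) \le C\tau^n$ for all $n\ge1$ and all $A_1,\dots,A_n\in\mathsf{A}$. *)

theory Defs
  imports "HOL-Analysis.Analysis" "HOL-Library.Multiset"
begin

section \<open>Lower spectral radius\<close>

text \<open>
  Exterior powers are realised below as subspaces of tensor powers, so the lower spectral radius
  is defined for maps that restrict to endomorphisms of a subspace \<open>W\<close>; only their values
  on \<open>W\<close> matter.  For \<open>W = UNIV\<close> the norm is the library's operator norm.
\<close>

definition onorm_on :: "'a::euclidean_space set \<Rightarrow> ('a \<Rightarrow> 'a) \<Rightarrow> real" where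
  "onorm_on W f = (SUP x\<in>W. norm (f x) / norm x)"

lemma onorm_on_UNIV: "onorm_on UNIV f = onorm f"
  by (simp add: onorm_on_def onorm_def)

text \<open>
  A list \<open>[f\<^sub>n, \<dots>, f\<^sub>1]\<close> stands for the product \<open>f\<^sub>n \<circ> \<dots> \<circ> f\<^sub>1\<close>.
  For nonempty compact sets of endomorphisms the limit exists by Fekete's lemma.
\<close>

definition lower_spectral_radius ::
    "'a::euclidean_space set \<Rightarrow> ('a \<Rightarrow> 'a) set \<Rightarrow> real" where
  "lower_spectral_radius W S =
     lim (\<lambda>n. INF fs\<in>{fs. length fs = n \<and> set fs \<subseteq> S}.
                root n (onorm_on W (foldr (\<circ>) fs id)))"

section \<open>Exterior powers\<close>

text \<open>
  The \<open>k\<close>th exterior power of \<open>\<real>\<^sup>n\<close> is taken inside the \<open>k\<close>th tensor power: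
  for an index type \<open>'k\<close> with \<open>k\<close> elements, a tensor has coordinates indexed by
  \<open>'k \<Rightarrow> 'n\<close>, and the wedge product of a family \<open>v\<close> is the antisymmetrisation
  \<open>\<Sum>\<^sub>\<pi> sgn(\<pi>) \<Otimes>\<^sub>i v (\<pi> i)\<close>, whose coordinates are the minors below.  The map induced by
  a matrix is the restriction of its tensor power, see \<open>ext_power_wedge\<close>.
\<close>

definition wedge :: "('k::finite \<Rightarrow> real ^ 'n) \<Rightarrow> real ^ ('k \<Rightarrow> 'n::finite)" where
  "wedge v = (\<chi> f. det (\<chi> i j. v i $ f j))"

definition ext_power_space :: "(real ^ ('k::finite \<Rightarrow> 'n::finite)) set" where
  "ext_power_space = span (range wedge)"

definition ext_power ::
    "real ^ 'n ^ 'n \<Rightarrow> real ^ ('k \<Rightarrow> 'n) \<Rightarrow> real ^ ('k::finite \<Rightarrow> 'n::finite)" where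
  "ext_power M t = (\<chi> f. \<Sum>g\<in>UNIV. (\<Prod>i\<in>UNIV. M $ f i $ g i) * t $ g)"

lemma linear_ext_power: "linear (ext_power M)"
  by (rule linearI)
     (simp_all add: ext_power_def vec_eq_iff sum.distrib algebra_simps sum_distrib_left)

lemma ext_power_wedge:
  fixes M :: "real ^ 'n ^ 'n" and v :: "'k::finite \<Rightarrow> real ^ 'n::finite"
  shows "ext_power M (wedge v) = wedge (\<lambda>i. M *v v i)"
proof -
  let ?P = "{p. p permutes (UNIV :: 'k set)}"
  have "wedge (\<lambda>i. M *v v i) $ f = ext_power M (wedge v) $ f" for f :: "'k \<Rightarrow> 'n"
  proof -
    have tr: "det (\<chi> i j. w i $ h j) =
        (\<Sum>p\<in>?P. of_int (sign p) * (\<Prod>j\<in>UNIV. w (p j) $ h j))"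
      for w :: "'k \<Rightarrow> real ^ 'n" and h :: "'k \<Rightarrow> 'n"
    proof -
      have "det (\<chi> i j. w i $ h j) = det (transpose (\<chi> i j. w i $ h j))"
        by (simp only: det_transpose)
      then show ?thesis
        by (simp add: det_def transpose_def)
    qed
    have "wedge (\<lambda>i. M *v v i) $ f =
        (\<Sum>p\<in>?P. of_int (sign p) *
          (\<Prod>j\<in>UNIV. \<Sum>b\<in>UNIV. M $ f j $ b * v (p j) $ b))"
      unfolding wedge_def vec_lambda_beta tr by (simp add: matrix_vector_mult_def)
    also have "\<dots> = (\<Sum>p\<in>?P. \<Sum>g\<in>UNIV. of_int (sign p) *
          (\<Prod>j\<in>UNIV. M $ f j $ g j * v (p j) $ g j))"
      by (simp add: prod_sum_PiE sum_distrib_left)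
    also have "\<dots> = (\<Sum>g\<in>UNIV. \<Sum>p\<in>?P. (\<Prod>j\<in>UNIV. M $ f j $ g j) *
          (of_int (sign p) * (\<Prod>j\<in>UNIV. v (p j) $ g j)))"
      by (subst sum.swap) (simp add: prod.distrib mult.left_commute)
    also have "\<dots> = ext_power M (wedge v) $ f"
      by (simp add: ext_power_def wedge_def tr sum_distrib_left)
    finally show ?thesis .
  qed
  then show ?thesis
    by (simp add: vec_eq_iff)
qed

lemma ext_power_in_ext_power_space:
  assumes "t \<in> ext_power_space"
  shows "ext_power M t \<in> ext_power_space"
proof -
  have "ext_power M ` span (range wedge) = span (ext_power M ` range wedge)"
    by (rule linear_span_image[OF linear_ext_power, symmetric])
  also have "\<dots> \<subseteq> span (range wedge)"
    by (rule span_mono) (auto simp: ext_power_wedge)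
  finally show ?thesis
    using assms by (auto simp: ext_power_space_def)
qed

section \<open>Singular values and domination\<close>

definition mat_eigenspace :: "real ^ 'n ^ 'n \<Rightarrow> real \<Rightarrow> (real ^ 'n) set" where
  "mat_eigenspace M l = {x. M *v x = l *\<^sub>R x}"

text \<open>
  Square roots of the eigenvalues of the symmetric matrix \<open>transpose M ** M\<close>, in decreasing
  order, each repeated according to its multiplicity.
\<close>

definition singular_values :: "real ^ 'n ^ 'n \<Rightarrow> real list" where
  "singular_values M =
     (let N = transpose M ** M in
      map sqrt (rev (sorted_list_of_multiset
        (\<Sum>l\<in>{l. mat_eigenspace N l \<noteq> {0}}. replicate_mset (dim (mat_eigenspace N l)) l))))"

text \<open>Singular values are numbered from 1 (largest) to \<open>CARD('n)\<close>.\<close>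

definition singular_value :: "nat \<Rightarrow> real ^ 'n ^ 'n \<Rightarrow> real" where
  "singular_value k M = singular_values M ! (k - 1)"

text \<open>
  To be used for nonempty compact sets of invertible matrices and \<open>1 \<le> k < CARD('n)\<close>.
\<close>

definition dominated :: "nat \<Rightarrow> (real ^ 'n ^ 'n) set \<Rightarrow> bool" where
  "dominated k A \<longleftrightarrow>
     (\<exists>C>1. \<exists>\<tau>\<in>{0<..<1}. \<forall>n\<ge>1. \<forall>Ms. length Ms = n \<and> set Ms \<subseteq> A \<longrightarrow>
        singular_value (k + 1) (foldr (**) Ms (mat 1)) / singular_value k (foldr (**) Ms (mat 1))
          \<le> C * \<tau> ^ n)"

section \<open>Planar matrices\<close>

definition GL2_plus :: "(real ^ 2 ^ 2) set" where
  "GL2_plus = {M. det M > 0}"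

definition rotation_mat :: "real \<Rightarrow> real ^ 2 ^ 2" where
  "rotation_mat \<theta> = vector [vector [cos \<theta>, - sin \<theta>], vector [sin \<theta>, cos \<theta>]]"

end

theory Submission
  imports Defs "HOL-Complex_Analysis.Conformal_Mappings"
begin

text \<open>
  Let \<open>\<rho>(\<theta>)\<close> be the lower spectral radius of \<open>R\<^sub>\<theta> A\<close> and let \<open>d\<close> be the least determinant on \<open>A\<close>,
  attained at \<open>B\<close>.  On the line \<open>\<Lambda>\<^sup>2 \<real>\<^sup>2\<close> a matrix acts as its determinant, so the
  hypothesis on exterior squares reads \<open>\<rho>(0) > sqrt d\<close> (\<open>lower_spectral_radius_ext_power\<close>).
  It therefore suffices to find angles \<open>\<theta>\<close> arbitrarily close to \<open>0\<close> at which \<open>\<rho>(\<theta>)\<close> is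
  arbitrarily close to \<open>sqrt d\<close>.

  For a word \<open>w = X\<^sub>1 \<dots> X\<^sub>n\<close> over \<open>A\<close> put \<open>M\<^sub>w(\<theta>) = R\<^sub>\<theta> X\<^sub>1 \<dots> R\<^sub>\<theta> X\<^sub>n\<close>; its determinant does not
  depend on \<open>\<theta>\<close>.  If \<open>M\<^sub>w(\<theta>)\<close> has trace zero, then its square is minus its determinant by
  Cayley-Hamilton, and hence \<open>\<rho>(\<theta>)\<close> is at most the \<open>2n\<close>-th root of the determinant
  (\<open>lower_spectral_radius_le_if_trace_zero\<close>).  This bound is close to \<open>sqrt d\<close> as soon as all but a
  bounded number of letters of \<open>w\<close> are equal to \<open>B\<close>.

  Trace zero is forced by rotation.  As all determinants are positive, every letter contributes
  positively to the speed at which the vector \<open>M\<^sub>w(\<theta>) e\<^sub>1\<close> turns when \<open>\<theta>\<close> grows (\<open>turn\<close>).  While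
  the vector makes a full turn it passes the two rays of the first axis, where it exhibits
  eigenvalues of opposite signs, so the trace vanishes in between (\<open>turning_trace_zero\<close>).  Suppose
  that some word \<open>P\<close> is elliptic (has nonreal eigenvalues) at some small angle \<open>\<theta>\<^sub>0\<close>.  Up to scalars
  the powers of \<open>M\<^sub>P(\<theta>)\<close> are uniformly bounded for \<open>\<theta>\<close> near \<open>\<theta>\<^sub>0\<close>, and the turning speed of \<open>P\<^sup>N w\<close>
  is at least \<open>N c\<close> with \<open>c > 0\<close> independent of \<open>w\<close> (\<open>elliptic_powers_turn\<close>).  Fix \<open>N\<close>
  so large that this is a full turn within a small interval around \<open>\<theta>\<^sub>0\<close>.  The words
  \<open>P\<^sup>N B\<^sup>m\<close>, with \<open>m\<close> tending to infinity, then do what is needed.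

  The word \<open>P\<close> comes from the failure of domination.  Suppose that no word is elliptic for
  \<open>\<bar>\<theta>\<bar> < \<eta>\<close>, and admit complex angles.  A rotation through an angle with imaginary part \<open>-s < 0\<close>
  strictly contracts a complex cone preserved by the real matrices of positive determinant, so
  that the normalised trace \<open>t(\<theta>) = tr M\<^sub>w(\<theta>) / sqrt (det M\<^sub>w)\<close> grows like \<open>exp (s n)\<close> and is never
  small and real.  Hence \<open>t\<close> omits \<open>[-1, 1]\<close> on the disc of radius \<open>\<eta>\<close>, and
  Harnack's inequality carries a third of the exponent from \<open>-i \<eta>/2\<close> to the angle \<open>0\<close>
  (\<open>slit_avoiding_growth\<close>).  A large trace makes the quotient of the singular values small, so \<open>A\<close>
  is dominated (\<open>dominated_if_no_elliptic_products\<close>).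
\<close>

section \<open>Upper bounds for the lower spectral radius\<close>

lemma foldr_comp_append: "foldr (\<circ>) (fs @ gs) id = foldr (\<circ>) fs id \<circ> foldr (\<circ>) gs id"
  by (induction fs) (auto simp: o_assoc)

lemma bounded_linear_foldr_comp:
  "(\<And>f. f \<in> set fs \<Longrightarrow> bounded_linear f) \<Longrightarrow> bounded_linear (foldr (\<circ>) fs id)"
  by (induction fs) (auto simp: o_def id_def intro: bounded_linear_compose)

lemma onorm_foldr_comp_append_le:
  assumes "\<And>f. f \<in> set (fs @ gs) \<Longrightarrow> bounded_linear f"
  shows "onorm (foldr (\<circ>) (fs @ gs) id) \<le> onorm (foldr (\<circ>) fs id) * onorm (foldr (\<circ>) gs id)"
  unfolding foldr_comp_append
  by (intro onorm_compose bounded_linear_foldr_comp) (use assms in auto)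

lemma onorm_foldr_comp_replicate_le:
  assumes "\<And>f. f \<in> set fs \<Longrightarrow> bounded_linear f"
  shows "onorm (foldr (\<circ>) (concat (replicate q fs)) id) \<le> onorm (foldr (\<circ>) fs id) ^ q"
proof (induction q)
  case 0
  then show ?case using onorm_id_le by (simp add: id_def)
next
  case (Suc q)
  have "onorm (foldr (\<circ>) (fs @ concat (replicate q fs)) id) \<le>
      onorm (foldr (\<circ>) fs id) * onorm (foldr (\<circ>) (concat (replicate q fs)) id)"
    by (rule onorm_foldr_comp_append_le) (use assms in \<open>auto split: if_splits\<close>)
  also have "\<dots> \<le> onorm (foldr (\<circ>) fs id) * onorm (foldr (\<circ>) fs id) ^ q"
    by (intro mult_left_mono Suc onorm_pos_le bounded_linear_foldr_comp assms)
  finally show ?case by (simp only: replicate.simps concat.simps power_Suc)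
qed

text \<open>
  The sequence in the definition of the lower spectral radius converges to its infimum, by the
  argument of Fekete's lemma: repeating a word of length \<open>m\<close> and filling up with fewer than \<open>m\<close>
  further letters bounds all later terms.  Convergence has to be proved along the way, since \<open>lim\<close>
  says nothing about a divergent sequence.
\<close>

lemma lower_spectral_radius_le:
  fixes S :: "('a::euclidean_space \<Rightarrow> 'a) set"
  assumes S: "\<And>f. f \<in> S \<Longrightarrow> bounded_linear f" and us: "set us \<subseteq> S" "us \<noteq> []"
  shows "lower_spectral_radius UNIV S \<le> root (length us) (onorm (foldr (\<circ>) us id))"
proof -
  define W where "W n = {fs. length fs = n \<and> set fs \<subseteq> S}" for n
  define N where "N fs = onorm (foldr (\<circ>) fs id)" for fs :: "('a \<Rightarrow> 'a) list"
  define a where "a n = (INF fs\<in>W n. root n (N fs))" for n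
  have bl: "bounded_linear f" if "fs \<in> W n" "f \<in> set fs" for f fs n
    using that S by (auto simp: W_def)
  have N0: "N fs \<ge> 0" if "fs \<in> W n" for fs n
    unfolding N_def by (intro onorm_pos_le bounded_linear_foldr_comp bl[OF that])
  have bdd: "bdd_below ((\<lambda>fs. root n (N fs)) ` W n)" for n
    by (rule bdd_belowI[of _ 0]) (auto dest: N0 intro: real_root_ge_zero)
  have a_le: "a n \<le> root n (N fs)" if "fs \<in> W n" for n fs
    unfolding a_def using bdd that by (rule cINF_lower)
  define f0 where "f0 = hd us"
  have f0: "f0 \<in> S" using us by (auto simp: f0_def)
  have W_ne: "W n \<noteq> {}" for n
    using f0 by (auto simp: W_def intro!: exI[of _ "replicate n f0"])
  have a0: "a n \<ge> 0" for n
    unfolding a_def by (rule cINF_greatest[OF W_ne]) (auto dest: N0 intro: real_root_ge_zero)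
  have upper: "\<exists>K>0. \<forall>n\<ge>1. a n \<le> x * root n K"
    if fs: "fs \<in> W m" and m: "m > 0" and x: "root m (N fs) < x" for fs m x
  proof -
    have x0: "x > 0"
      using x N0[OF fs] by (meson le_less_trans real_root_ge_zero)
    have Nx: "N fs \<le> x ^ m"
      using x m N0[OF fs] by (metis less_imp_le power_mono real_root_ge_zero real_root_pow_pos2)
    \<comment> \<open>\<open>C\<close> bounds the filling letters; \<open>D\<close> compensates for the powers of \<open>x\<close> that they do not supply.\<close>
    define C where "C = max 1 (onorm f0)"
    define D where "D = max 1 (1 / x)"
    have C: "C \<ge> 1" "onorm f0 \<le> C" and D: "D \<ge> 1" "1 \<le> D * x"
      using x0 by (auto simp: C_def D_def max_def field_simps)
    define K where "K = C ^ m * D ^ m"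
    have "a n \<le> x * root n K" if n: "n \<ge> 1" for n
    proof -
      define q r where "q = n div m" and "r = n mod m"
      have n_eq: "n = m * q + r" and r: "r < m" using m by (auto simp: q_def r_def)
      let ?gs = "concat (replicate q fs)" and ?hs = "concat (replicate r [f0])"
      have len: "length ?gs = q * m" "length ?hs = r"
        using fs by (auto simp: W_def length_concat sum_list_replicate)
      have sub: "set ?gs \<subseteq> S" "set ?hs \<subseteq> S"
        using fs f0 by (auto simp: W_def split: if_splits)
      have w: "?gs @ ?hs \<in> W n"
        using len sub by (simp add: W_def n_eq)
      have "N (?gs @ ?hs) \<le> N ?gs * N ?hs"
        unfolding N_def by (rule onorm_foldr_comp_append_le) (use S sub in auto)
      also have "\<dots> \<le> N fs ^ q * onorm f0 ^ r"
      proof (rule mult_mono)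
        show "N ?gs \<le> N fs ^ q"
          unfolding N_def by (rule onorm_foldr_comp_replicate_le) (rule bl[OF fs])
        show "N ?hs \<le> onorm f0 ^ r"
          unfolding N_def using onorm_foldr_comp_replicate_le[of "[f0]" r] S[OF f0] by simp
        show "0 \<le> N ?hs" using N0[of ?hs r] sub len by (simp add: W_def)
        show "0 \<le> N fs ^ q" using N0[OF fs] by simp
      qed
      also have "\<dots> \<le> (x ^ m) ^ q * C ^ m"
      proof (rule mult_mono)
        show "N fs ^ q \<le> (x ^ m) ^ q" using Nx N0[OF fs] by (rule power_mono)
        have "onorm f0 ^ r \<le> C ^ r" using C onorm_pos_le[OF S[OF f0]] by (intro power_mono)
        also have "\<dots> \<le> C ^ m" using C r by (intro power_increasing) auto
        finally show "onorm f0 ^ r \<le> C ^ m" .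
      qed (use x0 onorm_pos_le[OF S[OF f0]] in auto)
      also have "\<dots> \<le> (x ^ m) ^ q * C ^ m * (D * x) ^ r"
        using mult_left_mono[OF one_le_power[OF D(2), of r], of "(x ^ m) ^ q * C ^ m"] x0 C by simp
      also have "\<dots> = x ^ n * (C ^ m * D ^ r)"
        by (simp add: n_eq power_add power_mult power_mult_distrib)
      also have "\<dots> \<le> x ^ n * K"
        unfolding K_def using x0 C D r by (intro mult_left_mono power_increasing) auto
      finally have "N (?gs @ ?hs) \<le> x ^ n * K" .
      then have "root n (N (?gs @ ?hs)) \<le> root n (x ^ n * K)"
        using n by (intro real_root_le_mono) auto
      also have "\<dots> = x * root n K"
        using n x0 by (simp add: real_root_mult real_root_power_cancel)
      finally show ?thesis using a_le[OF w] by linarith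
    qed
    moreover have "K > 0" using C D by (auto simp: K_def)
    ultimately show ?thesis by blast
  qed
  define L where "L = (INF n\<in>{1..}. a n)"
  have bdd_a: "bdd_below (a ` {1..})" using a0 by (intro bdd_belowI[of _ 0]) auto
  have L_le: "L \<le> a n" if "n \<ge> 1" for n
    unfolding L_def using that by (intro cINF_lower bdd_a) auto
  have "a \<longlonglongrightarrow> L"
  proof (rule order_tendstoI)
    fix y assume "y < L"
    then show "\<forall>\<^sub>F n in sequentially. y < a n"
      using L_le by (intro eventually_sequentiallyI[of 1]) (auto intro: less_le_trans)
  next
    fix y assume "L < y"
    then obtain m where m: "m \<ge> 1" "a m < y"
      unfolding L_def using cINF_less_iff[OF _ bdd_a] by auto
    then obtain fs where fs: "fs \<in> W m" "root m (N fs) < y"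
      unfolding a_def using cINF_less_iff[OF W_ne bdd] by auto
    obtain x where x: "root m (N fs) < x" "x < y" using dense[OF fs(2)] by blast
    obtain K where K: "K > 0" "\<And>n. n \<ge> 1 \<Longrightarrow> a n \<le> x * root n K"
      using upper[OF fs(1) _ x(1)] m by auto
    have "(\<lambda>n. x * root n K) \<longlonglongrightarrow> x * 1"
      by (intro tendsto_intros LIMSEQ_root_const K)
    then have "\<forall>\<^sub>F n in sequentially. x * root n K < y"
      using x(2) by (intro order_tendstoD(2)[where y = "x * 1"]) auto
    with eventually_ge_at_top[of 1] show "\<forall>\<^sub>F n in sequentially. a n < y"
      by eventually_elim (use K(2) in force)
  qed
  then have "lim a = L" by (rule limI)
  moreover have "lower_spectral_radius UNIV S = lim a"
    unfolding lower_spectral_radius_def a_def N_def W_def onorm_on_UNIV ..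
  moreover have "L \<le> root (length us) (N us)"
    using L_le[of "length us"] a_le[of us "length us"] us by (fastforce simp: W_def Suc_le_eq)
  ultimately show ?thesis by (simp add: N_def)
qed


section \<open>The exterior square of the plane\<close>

text \<open>
  A wedge of two vectors in the plane is determined by one \<open>2 \<times> 2\<close> minor, and minors multiply.
\<close>

lemma ext_power_eq_det:
  fixes t :: "real ^ (2 \<Rightarrow> 2)" and M :: "real ^ 2 ^ 2"
  assumes "t \<in> ext_power_space"
  shows "ext_power M t = det M *\<^sub>R t"
proof -
  have w: "ext_power M (wedge v) = det M *\<^sub>R wedge v" for v :: "2 \<Rightarrow> real ^ 2"
  proof -
    have "wedge (\<lambda>i. M *v v i) $ f = det M * wedge v $ f" for f :: "2 \<Rightarrow> 2"
      using exhaust_2[of "f 1"] exhaust_2[of "f 2"]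
      by (auto simp: wedge_def det_2 matrix_vector_mult_def sum_2 algebra_simps)
    then show ?thesis by (simp add: ext_power_wedge vec_eq_iff)
  qed
  have "linear (\<lambda>t. det M *\<^sub>R t :: real ^ (2 \<Rightarrow> 2))" by (simp add: linear_iff algebra_simps)
  then show ?thesis
    by (rule linear_eq_on[OF linear_ext_power _ assms[unfolded ext_power_space_def]]) (auto simp: w)
qed

lemma wedge_axis_nonzero: "wedge (\<lambda>i::2. axis i 1 :: real ^ 2) \<noteq> 0"
proof -
  have "wedge (\<lambda>i::2. axis i 1 :: real ^ 2) $ id = 1"
    by (simp add: wedge_def det_2 axis_def)
  then show ?thesis by auto
qed

lemma onorm_on_scaling:
  fixes W :: "'a::euclidean_space set"
  assumes f: "\<And>x. x \<in> W \<Longrightarrow> f x = c *\<^sub>R x" and w: "w \<in> W" "w \<noteq> 0"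
  shows "onorm_on W f = \<bar>c\<bar>"
  unfolding onorm_on_def
proof (rule cSup_eq_maximum)
  show "\<bar>c\<bar> \<in> (\<lambda>x. norm (f x) / norm x) ` W"
    using w by (intro image_eqI[of _ _ w]) (auto simp: f)
qed (auto simp: f)

lemma ext_power_foldr:
  fixes Ms :: "(real ^ 2 ^ 2) list" and t :: "real ^ (2 \<Rightarrow> 2)"
  assumes "t \<in> ext_power_space"
  shows "foldr (\<circ>) (map ext_power Ms) id t = prod_list (map det Ms) *\<^sub>R t"
    and "foldr (\<circ>) (map ext_power Ms) id t \<in> ext_power_space"
proof (induction Ms)
  case (Cons M Ms)
  { case 1
    show ?case using Cons by (simp add: ext_power_eq_det)
  next
    case 2
    show ?case using Cons by (simp add: ext_power_in_ext_power_space)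
  }
qed (use assms in auto)

lemma prod_list_ge_power:
  fixes d :: real
  assumes "d \<ge> 0" "\<And>x. x \<in> set xs \<Longrightarrow> d \<le> x"
  shows "d ^ length xs \<le> prod_list xs"
  using assms(2)
proof (induction xs)
  case (Cons x xs)
  then have "d * d ^ length xs \<le> x * prod_list xs"
    using assms(1) by (intro mult_mono) (auto intro: order_trans[of _ d])
  then show ?case by simp
qed simp

text \<open>
  All terms of the defining sequence with positive index are equal to the minimal determinant: a
  product of \<open>n\<close> determinants is at least its \<open>n\<close>-th power, with equality for the constant word.
\<close>

lemma lower_spectral_radius_ext_power:
  fixes A :: "(real ^ 2 ^ 2) set"
  assumes B: "B \<in> A" "det B > 0" and min: "\<And>M. M \<in> A \<Longrightarrow> det B \<le> det M"
  shows "lower_spectral_radius (ext_power_space :: (real ^ (2 \<Rightarrow> 2)) set) (ext_power ` A) = det B"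
proof -
  let ?W = "ext_power_space :: (real ^ (2 \<Rightarrow> 2)) set"
  have norm_eq: "onorm_on ?W (foldr (\<circ>) (map ext_power Ms) id) = \<bar>prod_list (map det Ms)\<bar>" for Ms
    by (rule onorm_on_scaling[OF ext_power_foldr(1) _ wedge_axis_nonzero])
       (auto simp: ext_power_space_def intro: span_base)
  have "(INF fs\<in>{fs. length fs = n \<and> set fs \<subseteq> ext_power ` A}.
      root n (onorm_on ?W (foldr (\<circ>) fs id))) = det B" if n: "n > 0" for n
  proof (rule cInf_eq_minimum)
    have "root n (onorm_on ?W (foldr (\<circ>) (map ext_power (replicate n B)) id)) = det B"
      unfolding norm_eq using n B by (simp add: real_root_power_cancel)
    then show "det B \<in> (\<lambda>fs. root n (onorm_on ?W (foldr (\<circ>) fs id))) `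
        {fs. length fs = n \<and> set fs \<subseteq> ext_power ` A}"
      using B by (intro image_eqI[of _ _ "map ext_power (replicate n B)"]) auto
  next
    fix x assume "x \<in> (\<lambda>fs. root n (onorm_on ?W (foldr (\<circ>) fs id))) `
        {fs. length fs = n \<and> set fs \<subseteq> ext_power ` A}"
    then obtain fs where fs: "length fs = n" "fs \<in> lists (ext_power ` A)"
        and x: "x = root n (onorm_on ?W (foldr (\<circ>) fs id))"
      by (auto simp: in_lists_conv_set)
    then obtain Ms where Ms: "fs = map ext_power Ms" "Ms \<in> lists A"
      by (auto simp: lists_image)
    have "det B ^ length (map det Ms) \<le> prod_list (map det Ms)"
      using B Ms(2) min by (intro prod_list_ge_power) auto
    then have "det B ^ n \<le> \<bar>prod_list (map det Ms)\<bar>"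
      using fs Ms by simp
    then have "root n (det B ^ n) \<le> x"
      unfolding x Ms norm_eq using n by (intro real_root_le_mono)
    then show "det B \<le> x" using n B by (simp add: real_root_power_cancel)
  qed
  then have "(\<lambda>n. INF fs\<in>{fs. length fs = n \<and> set fs \<subseteq> ext_power ` A}.
      root n (onorm_on ?W (foldr (\<circ>) fs id))) \<longlonglongrightarrow> det B"
    by (intro tendsto_eventually eventually_sequentiallyI[of 1]) auto
  then show ?thesis
    unfolding lower_spectral_radius_def by (rule limI)
qed

section \<open>Singular values of planar matrices\<close>

lemma trace_2: "trace (M :: 'a::semiring_1 ^ 2 ^ 2) = M $ 1 $ 1 + M $ 2 $ 2"
  by (simp add: trace_def sum_2)

lemma mat_eigenspace_nontrivial_iff:
  fixes N :: "real ^ 2 ^ 2"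
  assumes "N $ 2 $ 1 = N $ 1 $ 2"
  shows "mat_eigenspace N l \<noteq> {0} \<longleftrightarrow> (N $ 1 $ 1 - l) * (N $ 2 $ 2 - l) = (N $ 1 $ 2)\<^sup>2"
proof -
  have "(N - mat l) *v x = N *v x - l *\<^sub>R x" for x
    by (simp add: vec_eq_iff forall_2 matrix_vector_mult_def mat_def sum_2 left_diff_distrib)
  then have "mat_eigenspace N l = {x. (N - mat l) *v x = 0}"
    by (simp add: mat_eigenspace_def)
  moreover have "det (N - mat l) = (N $ 1 $ 1 - l) * (N $ 2 $ 2 - l) - (N $ 1 $ 2)\<^sup>2"
    by (simp add: det_2 mat_def assms power2_eq_square)
  moreover have "(\<exists>x. x \<noteq> 0 \<and> (N - mat l) *v x = 0) \<longleftrightarrow> det (N - mat l) = 0"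
    using invertible_det_nz[of "N - mat l"] matrix_left_invertible_ker[of "N - mat l"]
      invertible_left_inverse[of "N - mat l"] by auto
  moreover have "mat_eigenspace N l \<noteq> {0} \<longleftrightarrow> (\<exists>x. x \<noteq> 0 \<and> x \<in> mat_eigenspace N l)"
    using matrix_vector_mult_0_right[of N] by (auto simp: mat_eigenspace_def)
  ultimately show ?thesis by simp
qed

lemma subspace_mat_eigenspace: "subspace (mat_eigenspace N l)"
  by (auto simp: subspace_def mat_eigenspace_def matrix_vector_right_distrib scaleR_right_distrib
      matrix_vector_mult_scaleR)

text \<open>
  With two distinct eigenvalues neither eigenspace can be the whole plane.  This yields the
  multiplicities that enter the list of singular values.
\<close>

lemma dim_mat_eigenspace_of_two:
  fixes N :: "real ^ 2 ^ 2"
  assumes ne: "l \<noteq> m" and l: "mat_eigenspace N l \<noteq> {0}" and m: "mat_eigenspace N m \<noteq> {0}"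
  shows "dim (mat_eigenspace N l) = 1"
proof -
  have zero: "0 \<in> mat_eigenspace N k" for k
    by (simp add: mat_eigenspace_def matrix_vector_mult_0_right)
  obtain x where x: "x \<in> mat_eigenspace N l" "x \<noteq> 0" using l zero by blast
  obtain y where y: "y \<in> mat_eigenspace N m" "y \<noteq> 0" using m zero by blast
  have "dim (mat_eigenspace N l) \<noteq> 0"
    using x by (auto simp: dim_eq_0)
  moreover have "dim (mat_eigenspace N l) \<noteq> 2"
  proof
    assume "dim (mat_eigenspace N l) = 2"
    then have "mat_eigenspace N l = UNIV"
      using dim_eq_full[of "mat_eigenspace N l"] span_eq_iff[THEN iffD2, OF subspace_mat_eigenspace[of N l]]
      by simp
    then have "y \<in> mat_eigenspace N l" by simp
    then have "N *v y = l *\<^sub>R y" unfolding mat_eigenspace_def by (rule CollectD)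
    moreover have "N *v y = m *\<^sub>R y" using y(1) unfolding mat_eigenspace_def by (rule CollectD)
    ultimately have "l *\<^sub>R y = m *\<^sub>R y" by (rule trans[OF sym])
    with y ne show False by simp
  qed
  moreover have "dim (mat_eigenspace N l) \<le> 2"
    using dim_subset_UNIV[of "mat_eigenspace N l"] by simp
  ultimately show ?thesis by linarith
qed

text \<open>
  The eigenvalues \<open>a \<ge> b\<close> of \<open>M\<^sup>T M\<close> have product \<open>(det M)\<^sup>2\<close>, and \<open>2 a\<close> is at least their sum, the
  squared Frobenius norm, which dominates half of the squared trace of \<open>M\<close>.
\<close>

lemma singular_values_2:
  fixes M :: "real ^ 2 ^ 2"
  obtains a b where "singular_values M = [sqrt a, sqrt b]" "a \<ge> b"
    "a * b = (det M)\<^sup>2" "(trace M)\<^sup>2 \<le> 4 * a"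
proof -
  define N where "N = transpose M ** M"
  define e f g where "e = N $ 1 $ 1" and "f = N $ 1 $ 2" and "g = N $ 2 $ 2"
  have sym: "N $ 2 $ 1 = N $ 1 $ 2"
    by (simp add: N_def transpose_def matrix_matrix_mult_def sum_2 mult.commute)
  \<comment> \<open>The square root of the discriminant of the characteristic polynomial of \<open>N\<close>.\<close>
  define \<Delta> where "\<Delta> = sqrt ((e - g)\<^sup>2 + 4 * f\<^sup>2)"
  define a b where "a = (e + g + \<Delta>) / 2" and "b = (e + g - \<Delta>) / 2"
  have \<Delta>: "\<Delta> \<ge> 0" "\<Delta>\<^sup>2 = (e - g)\<^sup>2 + 4 * f\<^sup>2" by (auto simp: \<Delta>_def)
  have "a \<ge> b" using \<Delta> by (simp add: a_def b_def)
  have ab: "a + b = e + g" "a * b = e * g - f\<^sup>2"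
    using \<Delta>(2) by (auto simp: a_def b_def field_simps power2_eq_square)
  have "(e - l) * (g - l) = f\<^sup>2 \<longleftrightarrow> l = a \<or> l = b" for l
  proof -
    have "(e - l) * (g - l) - f\<^sup>2 = a * b - (a + b) * l + l * l"
      unfolding ab by (simp add: algebra_simps)
    also have "\<dots> = (l - a) * (l - b)" by (simp add: algebra_simps)
    finally show ?thesis
      by (metis eq_iff_diff_eq_0 mult_eq_0_iff)
  qed
  then have eig: "mat_eigenspace N l \<noteq> {0} \<longleftrightarrow> l = a \<or> l = b" for l
    using mat_eigenspace_nontrivial_iff[OF sym] by (simp add: e_def f_def g_def)
  then have eig_set: "{l. mat_eigenspace N l \<noteq> {0}} = {a, b}" by auto
  have "(\<Sum>l\<in>{a, b}. replicate_mset (dim (mat_eigenspace N l)) l) = {#a, b#}"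
  proof (cases "a = b")
    case False
    then have "dim (mat_eigenspace N a) = 1" "dim (mat_eigenspace N b) = 1"
      using dim_mat_eigenspace_of_two[of a b N] dim_mat_eigenspace_of_two[of b a N] eig by auto
    with False show ?thesis by simp
  next
    case True
    then have "\<Delta>\<^sup>2 = 0" by (simp add: a_def b_def)
    then have "(e - g)\<^sup>2 = 0" "f\<^sup>2 = 0"
      using \<Delta>(2) zero_le_power2[of "e - g"] zero_le_power2[of f] by linarith+
    then have "e = g" "f = 0" by auto
    moreover have "a = e" using True ab(1) \<open>e = g\<close> by simp
    ultimately have "N *v x = a *\<^sub>R x" for x
      using sym by (simp add: vec_eq_iff forall_2 matrix_vector_mult_def sum_2 e_def f_def g_def)
    then have "mat_eigenspace N a = UNIV" by (auto simp: mat_eigenspace_def)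
    then have "dim (mat_eigenspace N a) = 2" by simp
    with True show ?thesis by (simp add: numeral_2_eq_2)
  qed
  then have sv: "singular_values M = [sqrt a, sqrt b]"
    using \<open>a \<ge> b\<close> unfolding singular_values_def Let_def N_def[symmetric] eig_set by auto
  have "e * g - f\<^sup>2 = det N"
    by (simp add: det_2 sym e_def f_def g_def power2_eq_square)
  then have det: "a * b = (det M)\<^sup>2"
    unfolding ab by (simp add: N_def det_mul det_transpose power2_eq_square)
  have "e + g = (M$1$1)\<^sup>2 + (M$2$1)\<^sup>2 + (M$1$2)\<^sup>2 + (M$2$2)\<^sup>2"
    by (simp add: e_def g_def N_def transpose_def matrix_matrix_mult_def sum_2 power2_eq_square)
  moreover have "(M$1$1 + M$2$2)\<^sup>2 + (M$1$1 - M$2$2)\<^sup>2 = 2 * (M$1$1)\<^sup>2 + 2 * (M$2$2)\<^sup>2"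
    by (simp add: power2_eq_square algebra_simps)
  moreover have "2 * a \<ge> e + g" using \<Delta> by (simp add: a_def)
  moreover have "(M$1$1 - M$2$2)\<^sup>2 \<ge> 0" "(M$2$1)\<^sup>2 \<ge> 0" "(M$1$2)\<^sup>2 \<ge> 0" by simp_all
  ultimately have tr: "(trace M)\<^sup>2 \<le> 4 * a"
    unfolding trace_2 by linarith
  show ?thesis by (rule that[OF sv \<open>a \<ge> b\<close> det tr])
qed

text \<open>
  This is how an exponentially growing normalised trace turns into domination.
\<close>

lemma singular_value_ratio_le:
  fixes M :: "real ^ 2 ^ 2"
  assumes "det M > 0" "trace M \<noteq> 0"
  shows "singular_value 2 M / singular_value 1 M \<le> 4 * det M / (trace M)\<^sup>2"
proof -
  obtain a b where ab: "singular_values M = [sqrt a, sqrt b]" "a \<ge> b"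
    "a * b = (det M)\<^sup>2" "(trace M)\<^sup>2 \<le> 4 * a"
    by (rule singular_values_2)
  have "(trace M)\<^sup>2 > 0" using assms by simp
  with ab have a: "a > 0" by linarith
  have "sqrt b / sqrt a = sqrt (a * b) / a"
    using a by (simp add: real_sqrt_mult field_simps)
  also have "\<dots> = det M / a" using ab(3) assms by simp
  also have "\<dots> \<le> det M / ((trace M)\<^sup>2 / 4)"
    using ab assms a by (intro divide_left_mono) auto
  finally show ?thesis by (simp add: singular_value_def ab(1) mult.commute)
qed

section \<open>Planar matrices in complex coordinates\<close>

text \<open>
  Identify the plane with the complex numbers.  A real matrix then acts as
  \<open>z \<mapsto> p z + q cnj z\<close> for unique complex \<open>p\<close> and \<open>q\<close>, its complex linear and antilinear parts.
  Rotations have \<open>q = 0\<close>, and trace and determinant become \<open>2 Re p\<close> and \<open>\<bar>p\<bar>\<^sup>2 - \<bar>q\<bar>\<^sup>2\<close>.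
\<close>

definition hol_part :: "real ^ 2 ^ 2 \<Rightarrow> complex" where
  "hol_part X = Complex ((X$1$1 + X$2$2) / 2) ((X$2$1 - X$1$2) / 2)"

definition antihol_part :: "real ^ 2 ^ 2 \<Rightarrow> complex" where
  "antihol_part X = Complex ((X$1$1 - X$2$2) / 2) ((X$2$1 + X$1$2) / 2)"

definition plane_act :: "real ^ 2 ^ 2 \<Rightarrow> complex \<Rightarrow> complex" where
  "plane_act X z = hol_part X * z + antihol_part X * cnj z"

lemma det_eq_parts: "det X = (cmod (hol_part X))\<^sup>2 - (cmod (antihol_part X))\<^sup>2"
  unfolding det_2 cmod_power2 by (simp add: hol_part_def antihol_part_def power2_eq_square field_simps)

lemma trace_eq_hol_part: "trace X = 2 * Re (hol_part X)"
  by (simp add: trace_2 hol_part_def)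

lemma parts_mult:
  "hol_part (X ** Y) = hol_part X * hol_part Y + antihol_part X * cnj (antihol_part Y)"
  "antihol_part (X ** Y) = hol_part X * antihol_part Y + antihol_part X * cnj (hol_part Y)"
  by (simp_all add: complex_eq_iff hol_part_def antihol_part_def matrix_matrix_mult_def sum_2 field_simps)

lemma parts_mat_1 [simp]: "hol_part (mat 1) = 1" "antihol_part (mat 1) = 0"
  by (simp_all add: complex_eq_iff hol_part_def antihol_part_def mat_def)

lemma parts_rotation [simp]:
  "hol_part (rotation_mat \<theta>) = cis \<theta>" "antihol_part (rotation_mat \<theta>) = 0"
  by (simp_all add: complex_eq_iff hol_part_def antihol_part_def rotation_mat_def vector_2)

lemma plane_act_mult: "plane_act (X ** Y) z = plane_act X (plane_act Y z)"
  by (simp add: plane_act_def parts_mult algebra_simps)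

lemma plane_act_rotation: "plane_act (rotation_mat \<theta>) z = cis \<theta> * z"
  by (simp add: plane_act_def)

lemma plane_act_mat_1 [simp]: "plane_act (mat 1) z = z"
  by (simp add: plane_act_def)

lemma det_rotation_mat [simp]: "det (rotation_mat \<theta>) = 1"
  by (simp add: det_eq_parts)

lemma rotation_mat_0 [simp]: "rotation_mat 0 = mat 1"
  by (simp add: rotation_mat_def vec_eq_iff forall_2 vector_2 mat_def)

text \<open>
  \<open>Im (cnj z * y)\<close> is the oriented area spanned by \<open>z\<close> and \<open>y\<close>, which the matrix scales by its
  determinant.
\<close>

lemma Im_cnj_plane_act:
  "Im (cnj (plane_act X z) * plane_act X y) = det X * Im (cnj z * y)"
  unfolding det_eq_parts cmod_power2 plane_act_def
  by (simp add: power2_eq_square algebra_simps)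

lemma plane_act_nonzero:
  assumes "det X > 0" "z \<noteq> 0"
  shows "plane_act X z \<noteq> 0"
proof
  assume "plane_act X z = 0"
  then have "det X * Im (cnj z * (\<i> * z)) = 0"
    using Im_cnj_plane_act[of X z "\<i> * z"] by simp
  moreover have "Im (cnj z * (\<i> * z)) = (cmod z)\<^sup>2"
    unfolding cmod_power2 by (simp add: power2_eq_square)
  ultimately show False using assms by simp
qed


section \<open>Rotated products and their turning speed\<close>

primrec rot_prod :: "real \<Rightarrow> (real ^ 2 ^ 2) list \<Rightarrow> real ^ 2 ^ 2" where
  "rot_prod \<theta> [] = mat 1"
| "rot_prod \<theta> (X # w) = rotation_mat \<theta> ** X ** rot_prod \<theta> w"

lemma rot_prod_append: "rot_prod \<theta> (v @ w) = rot_prod \<theta> v ** rot_prod \<theta> w"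
  by (induction v) (simp_all add: matrix_mul_assoc)

lemma det_rot_prod: "det (rot_prod \<theta> w) = prod_list (map det w)"
  by (induction w) (simp_all add: det_mul)

lemma det_rot_prod_pos:
  assumes "set w \<subseteq> GL2_plus" shows "det (rot_prod \<theta> w) > 0"
  using assms by (induction w) (auto simp: det_mul GL2_plus_def)

lemma plane_act_rot_prod_Cons:
  "plane_act (rot_prod \<theta> (X # w)) z = cis \<theta> * plane_act X (plane_act (rot_prod \<theta> w) z)"
  by (simp add: plane_act_mult plane_act_rotation)

lemma continuous_parts_rot_prod:
  "isCont (\<lambda>\<theta>. hol_part (rot_prod \<theta> w)) \<theta>" "isCont (\<lambda>\<theta>. antihol_part (rot_prod \<theta> w)) \<theta>"
proof (induction w)
  case (Cons X w)
  have "isCont cis \<theta>" by (simp add: cis_conv_exp[abs_def])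
  { case 1 show ?case by (simp add: parts_mult) (intro continuous_intros Cons \<open>isCont cis \<theta>\<close>)
  next
    case 2 show ?case by (simp add: parts_mult) (intro continuous_intros Cons \<open>isCont cis \<theta>\<close>) }
qed auto

text \<open>
  The oriented area spanned by the vector \<open>M\<^sub>w(\<theta>) z\<close> and its derivative in \<open>\<theta>\<close>; divided by the
  squared length of the vector it is the angular velocity.  The first rotation contributes the
  squared length, the others are transported by \<open>X\<close>, which multiplies areas by \<open>det X\<close>.
\<close>

primrec turn :: "real \<Rightarrow> (real ^ 2 ^ 2) list \<Rightarrow> complex \<Rightarrow> real" where
  "turn \<theta> [] z = 0"
| "turn \<theta> (X # w) z = (cmod (plane_act (rot_prod \<theta> (X # w)) z))\<^sup>2 + det X * turn \<theta> w z"

lemma bounded_linear_plane_act: "bounded_linear (plane_act X)"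
  unfolding plane_act_def[abs_def]
  by (intro bounded_linear_add bounded_linear_mult_right
      bounded_linear_compose[OF bounded_linear_mult_right bounded_linear_cnj])

text \<open>
  The derivative is kept existential, since only the oriented area matters.
\<close>

lemma rot_prod_orbit_derivative:
  "\<exists>D. ((\<lambda>\<theta>. plane_act (rot_prod \<theta> w) z) has_vector_derivative D) (at \<theta>) \<and>
       Im (cnj (plane_act (rot_prod \<theta> w) z) * D) = turn \<theta> w z"
proof (induction w)
  case Nil
  show ?case by (intro exI[of _ 0]) (auto intro: derivative_eq_intros)
next
  case (Cons X w)
  define y where "y \<theta> = plane_act (rot_prod \<theta> w) z" for \<theta>
  obtain D where D: "(y has_vector_derivative D) (at \<theta>)" "Im (cnj (y \<theta>) * D) = turn \<theta> w z"
    using Cons by (auto simp: y_def[abs_def])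
  have cis: "(cis has_vector_derivative (\<i> * cis \<theta>)) (at \<theta>)"
    using has_derivative_cis[OF has_derivative_ident, of \<theta> UNIV]
    by (simp add: has_vector_derivative_def)
  have act: "((\<lambda>\<theta>. plane_act X (y \<theta>)) has_vector_derivative plane_act X D) (at \<theta>)"
    by (rule bounded_linear.has_vector_derivative[OF bounded_linear_plane_act D(1)])
  define E where "E = cis \<theta> * plane_act X D + \<i> * cis \<theta> * plane_act X (y \<theta>)"
  have "((\<lambda>\<theta>. cis \<theta> * plane_act X (y \<theta>)) has_vector_derivative E) (at \<theta>)"
    unfolding E_def by (rule has_vector_derivative_mult[OF cis act])
  moreover have "Im (cnj (cis \<theta> * plane_act X (y \<theta>)) * E) = turn \<theta> (X # w) z"
  proof -
    have "cnj (cis \<theta>) * cis \<theta> = 1"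
      by (metis complex_norm_square mult.commute norm_cis of_real_1 one_power2)
    moreover have "cnj (cis \<theta> * plane_act X (y \<theta>)) * E = (cnj (cis \<theta>) * cis \<theta>) *
        (cnj (plane_act X (y \<theta>)) * plane_act X D + \<i> * (cnj (plane_act X (y \<theta>)) * plane_act X (y \<theta>)))"
      by (simp add: E_def algebra_simps)
    ultimately have "cnj (cis \<theta> * plane_act X (y \<theta>)) * E =
        cnj (plane_act X (y \<theta>)) * plane_act X D + \<i> * (cnj (plane_act X (y \<theta>)) * plane_act X (y \<theta>))"
      by simp
    also have "Im \<dots> = det X * Im (cnj (y \<theta>) * D) + (cmod (plane_act X (y \<theta>)))\<^sup>2"
      unfolding plus_complex.sel Im_cnj_plane_act cmod_power2
      by (simp add: power2_eq_square)
    also have "\<dots> = turn \<theta> (X # w) z"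
      unfolding turn.simps plane_act_rot_prod_Cons D(2) by (simp add: norm_mult y_def)
    finally show ?thesis .
  qed
  ultimately show ?case unfolding plane_act_rot_prod_Cons y_def by blast
qed

text \<open>
  On a curve avoiding the slit the argument is the imaginary part of the principal
  logarithm.  It varies by less than \<open>2 \<pi>\<close>, whereas the angular velocity makes it grow by at
  least \<open>2 \<pi>\<close>.  The principal branch thus replaces a continuous choice of the argument.
\<close>

lemma turning_curve_meets_negative_axis:
  fixes \<gamma> :: "real \<Rightarrow> complex"
  assumes "a < b" and full: "c * (b - a) \<ge> 2 * pi"
    and deriv: "\<And>\<theta>. \<theta> \<in> {a..b} \<Longrightarrow> \<exists>D. (\<gamma> has_vector_derivative D) (at \<theta>) \<and>
       c * (cmod (\<gamma> \<theta>))\<^sup>2 \<le> Im (cnj (\<gamma> \<theta>) * D)"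
  shows "\<exists>\<theta>\<in>{a..b}. \<gamma> \<theta> \<in> \<real>\<^sub>\<le>\<^sub>0"
proof (rule ccontr)
  assume "\<not> ?thesis"
  then have slit: "\<gamma> \<theta> \<notin> \<real>\<^sub>\<le>\<^sub>0" if "\<theta> \<in> {a..b}" for \<theta> using that by blast
  obtain D where D: "\<And>\<theta>. \<theta> \<in> {a..b} \<Longrightarrow> (\<gamma> has_vector_derivative D \<theta>) (at \<theta>)"
    "\<And>\<theta>. \<theta> \<in> {a..b} \<Longrightarrow> c * (cmod (\<gamma> \<theta>))\<^sup>2 \<le> Im (cnj (\<gamma> \<theta>) * D \<theta>)"
    using deriv by metis
  have "((\<lambda>\<theta>. Im (Ln (\<gamma> \<theta>))) has_real_derivative Im (D \<theta> * inverse (\<gamma> \<theta>))) (at \<theta>)"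
    if \<theta>: "\<theta> \<in> {a..b}" for \<theta>
  proof -
    have "((Ln \<circ> \<gamma>) has_vector_derivative D \<theta> * inverse (\<gamma> \<theta>)) (at \<theta>)"
      by (intro field_vector_diff_chain_at D \<theta> has_field_derivative_Ln slit)
    then show ?thesis
      unfolding has_real_derivative_iff_has_vector_derivative o_def
      by (rule bounded_linear.has_vector_derivative[OF bounded_linear_Im])
  qed
  then obtain x where x: "a < x" "x < b"
    "Im (Ln (\<gamma> b)) - Im (Ln (\<gamma> a)) = (b - a) * Im (D x * inverse (\<gamma> x))"
    using MVT2[OF \<open>a < b\<close>, of "\<lambda>\<theta>. Im (Ln (\<gamma> \<theta>))" "\<lambda>\<theta>. Im (D \<theta> * inverse (\<gamma> \<theta>))"] by auto
  have nz: "\<gamma> \<theta> \<noteq> 0" if "\<theta> \<in> {a..b}" for \<theta> using slit[OF that] by auto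
  have "D x * inverse (\<gamma> x) = cnj (\<gamma> x) * D x / of_real ((cmod (\<gamma> x))\<^sup>2)"
    using nz[of x] x unfolding complex_norm_square by (simp add: field_simps)
  then have "Im (D x * inverse (\<gamma> x)) = Im (cnj (\<gamma> x) * D x) / (cmod (\<gamma> x))\<^sup>2"
    by (simp only: Im_divide_of_real)
  moreover have "\<dots> \<ge> c"
    using D(2)[of x] nz[of x] x by (simp add: pos_le_divide_eq)
  ultimately have "(b - a) * Im (D x * inverse (\<gamma> x)) \<ge> (b - a) * c"
    using \<open>a < b\<close> by (intro mult_left_mono) auto
  then have "Im (Ln (\<gamma> b)) - Im (Ln (\<gamma> a)) \<ge> 2 * pi"
    unfolding x(3) using full by (simp only: mult.commute[of c])
  moreover have "Im (Ln (\<gamma> b)) < pi" "Im (Ln (\<gamma> a)) > - pi"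
    using Im_Ln_less_pi[OF slit[of b]] mpi_less_Im_Ln[OF nz[of a]] \<open>a < b\<close> by auto
  ultimately show False by linarith
qed

text \<open>
  When the first column lies on the negative (positive) real axis, it shows a negative (positive)
  eigenvalue.  The other eigenvalue has the same sign because the determinant is positive.  A full
  turn meets both rays, so the trace takes both signs.
\<close>

lemma turning_trace_zero:
  assumes w: "set w \<subseteq> GL2_plus" and "a < b" and full: "c * (b - a) \<ge> 2 * pi"
    and fast: "\<And>\<theta>. \<theta> \<in> {a..b} \<Longrightarrow> c * (cmod (plane_act (rot_prod \<theta> w) 1))\<^sup>2 \<le> turn \<theta> w 1"
  shows "\<exists>\<theta>\<in>{a..b}. trace (rot_prod \<theta> w) = 0"
proof -
  define \<gamma> where "\<gamma> \<theta> = plane_act (rot_prod \<theta> w) 1" for \<theta>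
  have deriv: "\<exists>D. (\<gamma> has_vector_derivative D) (at \<theta>) \<and> c * (cmod (\<gamma> \<theta>))\<^sup>2 \<le> Im (cnj (\<gamma> \<theta>) * D)"
    if "\<theta> \<in> {a..b}" for \<theta>
    using rot_prod_orbit_derivative[of w 1 \<theta>] fast[OF that] by (auto simp: \<gamma>_def[abs_def])
  have nz: "\<gamma> \<theta> \<noteq> 0" for \<theta>
    unfolding \<gamma>_def by (intro plane_act_nonzero det_rot_prod_pos w) simp
  \<comment> \<open>On the axis the sign of \<open>Re (p + q)\<close> is that of \<open>Re p\<close>, half of the trace.\<close>
  have sgn: "\<bar>Re (antihol_part (rot_prod \<theta> w))\<bar> < \<bar>Re (hol_part (rot_prod \<theta> w))\<bar>"
    if "Im (\<gamma> \<theta>) = 0" for \<theta>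
  proof -
    have "(Im (hol_part (rot_prod \<theta> w)))\<^sup>2 = (Im (antihol_part (rot_prod \<theta> w)))\<^sup>2"
      using that by (simp add: \<gamma>_def plane_act_def power2_eq_iff add_eq_0_iff)
    then have "(Re (antihol_part (rot_prod \<theta> w)))\<^sup>2 < (Re (hol_part (rot_prod \<theta> w)))\<^sup>2"
      using det_rot_prod_pos[OF w, of \<theta>] by (simp add: det_eq_parts cmod_power2)
    then show ?thesis using power2_less_imp_less[of "\<bar>Re (antihol_part (rot_prod \<theta> w))\<bar>" "\<bar>Re (hol_part (rot_prod \<theta> w))\<bar>"] by simp
  qed
  obtain \<theta>1 where \<theta>1: "\<theta>1 \<in> {a..b}" "\<gamma> \<theta>1 \<in> \<real>\<^sub>\<le>\<^sub>0"
    using turning_curve_meets_negative_axis[OF \<open>a < b\<close> full deriv] by blast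
  then have "Im (\<gamma> \<theta>1) = 0" "Re (\<gamma> \<theta>1) \<le> 0" by (auto simp: complex_nonpos_Reals_iff)
  with sgn[of \<theta>1] have neg: "trace (rot_prod \<theta>1 w) \<le> 0"
    by (simp add: trace_eq_hol_part \<gamma>_def plane_act_def)
  have deriv': "\<exists>D. ((\<lambda>\<theta>. - \<gamma> \<theta>) has_vector_derivative D) (at \<theta>) \<and>
      c * (cmod (- \<gamma> \<theta>))\<^sup>2 \<le> Im (cnj (- \<gamma> \<theta>) * D)" if \<theta>: "\<theta> \<in> {a..b}" for \<theta>
  proof -
    obtain D where "(\<gamma> has_vector_derivative D) (at \<theta>)" "c * (cmod (\<gamma> \<theta>))\<^sup>2 \<le> Im (cnj (\<gamma> \<theta>) * D)"
      using deriv[OF \<theta>] by blast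
    then show ?thesis
      by (intro exI[of _ "- D"] conjI has_vector_derivative_minus) auto
  qed
  obtain \<theta>2 where \<theta>2: "\<theta>2 \<in> {a..b}" "- \<gamma> \<theta>2 \<in> \<real>\<^sub>\<le>\<^sub>0"
    using turning_curve_meets_negative_axis[OF \<open>a < b\<close> full deriv'] by blast
  then have "Im (\<gamma> \<theta>2) = 0" "Re (\<gamma> \<theta>2) \<ge> 0" by (auto simp: complex_nonpos_Reals_iff)
  with sgn[of \<theta>2] have pos: "trace (rot_prod \<theta>2 w) \<ge> 0"
    by (simp add: trace_eq_hol_part \<gamma>_def plane_act_def)
  have "continuous_on {a..b} (\<lambda>\<theta>. trace (rot_prod \<theta> w))"
    unfolding trace_eq_hol_part
    by (intro continuous_at_imp_continuous_on ballI continuous_intros continuous_parts_rot_prod)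
  then have "connected ((\<lambda>\<theta>. trace (rot_prod \<theta> w)) ` {a..b})"
    by (intro connected_continuous_image) auto
  then have "{trace (rot_prod \<theta>1 w)..trace (rot_prod \<theta>2 w)} \<subseteq> (\<lambda>\<theta>. trace (rot_prod \<theta> w)) ` {a..b}"
    using \<theta>1 \<theta>2 by (intro connected_contains_Icc) auto
  with neg pos have "0 \<in> (\<lambda>\<theta>. trace (rot_prod \<theta> w)) ` {a..b}" by auto
  then show ?thesis by force
qed

lemma turn_nonneg: "set w \<subseteq> GL2_plus \<Longrightarrow> turn \<theta> w z \<ge> 0"
  by (induction w) (auto simp: GL2_plus_def)

lemma turn_append:
  "turn \<theta> (v @ w) z = turn \<theta> v (plane_act (rot_prod \<theta> w) z) + det (rot_prod \<theta> v) * turn \<theta> w z"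
  by (induction v) (simp_all add: rot_prod_append plane_act_mult det_mul algebra_simps)

lemma turn_ge:
  assumes "set w \<subseteq> GL2_plus" "w \<noteq> []"
  shows "turn \<theta> w z \<ge> (cmod (plane_act (rot_prod \<theta> w) z))\<^sup>2"
  using assms turn_nonneg[of "tl w" \<theta> z] by (cases w) (auto simp: GL2_plus_def)

text \<open>
  The quadratic form \<open>z \<mapsto> Im (cnj z * P z)\<close> (the oriented area of \<open>z\<close> and \<open>P z\<close>) is multiplied by
  \<open>det P\<close> under \<open>P\<close> and is definite exactly when \<open>P\<close> is elliptic.  Comparing it with the squared length
  shows that all powers of \<open>P\<close> are conformal up to a constant, uniformly for angles near \<open>\<theta>\<^sub>0\<close>, so each of the
  \<open>N\<close> copies of \<open>P\<close> adds at least a fixed amount to the angular velocity, whatever \<open>w\<close> is.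
\<close>

lemma elliptic_powers_turn:
  assumes P: "set P \<subseteq> GL2_plus" "P \<noteq> []"
    and ell: "(trace (rot_prod \<theta>0 P))\<^sup>2 \<le> det (rot_prod \<theta>0 P)"
  obtains \<epsilon> c where "\<epsilon> > 0" "c > 0"
    "\<And>\<theta> N w z. \<bar>\<theta> - \<theta>0\<bar> \<le> \<epsilon> \<Longrightarrow> set w \<subseteq> GL2_plus \<Longrightarrow>
       N * c * (cmod (plane_act (rot_prod \<theta> (concat (replicate N P) @ w)) z))\<^sup>2
         \<le> turn \<theta> (concat (replicate N P) @ w) z"
proof -
  define p where "p \<theta> = hol_part (rot_prod \<theta> P)" for \<theta>
  define q where "q \<theta> = antihol_part (rot_prod \<theta> P)" for \<theta>
  define form where "form \<theta> z = Im (cnj z * plane_act (rot_prod \<theta> P) z)" for \<theta> z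
  have form_eq: "form \<theta> z = Im (p \<theta>) * (cmod z)\<^sup>2 + Im (q \<theta> * (cnj z)\<^sup>2)" for \<theta> z
    unfolding form_def plane_act_def p_def q_def cmod_power2
    by (simp add: power2_eq_square algebra_simps)
  have Im_q: "\<bar>Im (q \<theta> * (cnj z)\<^sup>2)\<bar> \<le> cmod (q \<theta>) * (cmod z)\<^sup>2" for \<theta> z
    using abs_Im_le_cmod[of "q \<theta> * (cnj z)\<^sup>2"] by (simp add: norm_mult norm_power)
  have form_le: "\<bar>form \<theta> z\<bar> \<le> (\<bar>Im (p \<theta>)\<bar> + cmod (q \<theta>)) * (cmod z)\<^sup>2"
   and form_ge: "\<bar>form \<theta> z\<bar> \<ge> (\<bar>Im (p \<theta>)\<bar> - cmod (q \<theta>)) * (cmod z)\<^sup>2" for \<theta> z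
  proof -
    have "\<bar>Im (p \<theta>) * (cmod z)\<^sup>2\<bar> = \<bar>Im (p \<theta>)\<bar> * (cmod z)\<^sup>2" by (simp add: abs_mult)
    then show "\<bar>form \<theta> z\<bar> \<le> (\<bar>Im (p \<theta>)\<bar> + cmod (q \<theta>)) * (cmod z)\<^sup>2"
      "\<bar>form \<theta> z\<bar> \<ge> (\<bar>Im (p \<theta>)\<bar> - cmod (q \<theta>)) * (cmod z)\<^sup>2"
      using Im_q[of \<theta> z] unfolding form_eq distrib_right left_diff_distrib by linarith+
  qed
  \<comment> \<open>\<open>(Im p)\<^sup>2 - \<bar>q\<bar>\<^sup>2 = det P - (tr P)\<^sup>2 / 4\<close>, so the form is definite at \<open>\<theta>\<^sub>0\<close>.\<close>
  have "(cmod (q \<theta>0))\<^sup>2 < \<bar>Im (p \<theta>0)\<bar>\<^sup>2"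
    using ell det_rot_prod_pos[OF P(1), of \<theta>0]
    unfolding trace_eq_hol_part det_eq_parts p_def q_def
    by (simp add: cmod_power2 power_mult_distrib)
  then have gap: "\<bar>Im (p \<theta>0)\<bar> - cmod (q \<theta>0) > 0"
    using power_less_imp_less_base[of "cmod (q \<theta>0)" 2 "\<bar>Im (p \<theta>0)\<bar>"] by simp
  define c1 where "c1 = (\<bar>Im (p \<theta>0)\<bar> - cmod (q \<theta>0)) / 2"
  define c2 where "c2 = \<bar>Im (p \<theta>0)\<bar> + cmod (q \<theta>0) + 1"
  have c1: "c1 > 0" "c1 < \<bar>Im (p \<theta>0)\<bar> - cmod (q \<theta>0)" using gap by (auto simp: c1_def)
  have c2: "c2 > 0" "\<bar>Im (p \<theta>0)\<bar> + cmod (q \<theta>0) < c2"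
    by (auto simp: c2_def intro: add_nonneg_pos)
  have cont: "isCont p \<theta>0" "isCont q \<theta>0"
    unfolding p_def q_def by (rule continuous_parts_rot_prod)+
  have "isCont (\<lambda>\<theta>. \<bar>Im (p \<theta>)\<bar> - cmod (q \<theta>)) \<theta>0" "isCont (\<lambda>\<theta>. \<bar>Im (p \<theta>)\<bar> + cmod (q \<theta>)) \<theta>0"
    by (rule isCont_diff isCont_add isCont_rabs isCont_Im isCont_norm cont)+
  then have "\<forall>\<^sub>F \<theta> in at \<theta>0. c1 < \<bar>Im (p \<theta>)\<bar> - cmod (q \<theta>) \<and> \<bar>Im (p \<theta>)\<bar> + cmod (q \<theta>) < c2"
    using c1 c2 by (intro eventually_conj order_tendstoD[OF isContD])
  then obtain e where e: "e > 0"
    "\<And>\<theta>. \<theta> \<noteq> \<theta>0 \<Longrightarrow> \<bar>\<theta> - \<theta>0\<bar> < e \<Longrightarrow> c1 < \<bar>Im (p \<theta>)\<bar> - cmod (q \<theta>) \<and> \<bar>Im (p \<theta>)\<bar> + cmod (q \<theta>) < c2"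
    by (auto simp: eventually_at dist_real_def)
  have bounds: "c1 < \<bar>Im (p \<theta>)\<bar> - cmod (q \<theta>)" "\<bar>Im (p \<theta>)\<bar> + cmod (q \<theta>) < c2"
    if "\<bar>\<theta> - \<theta>0\<bar> \<le> e / 2" for \<theta>
    using e(2)[of \<theta>] that e(1) c1 c2 by (cases "\<theta> = \<theta>0"; auto)+
  show ?thesis
  proof (rule that[of "e / 2" "c1 / c2"])
    show "e / 2 > 0" "c1 / c2 > 0" using e c1 c2 by auto
  next
    fix \<theta> N w z
    assume \<theta>: "\<bar>\<theta> - \<theta>0\<bar> \<le> e / 2" and w: "set w \<subseteq> GL2_plus"
    define y where "y N = plane_act (rot_prod \<theta> (concat (replicate N P) @ w)) z" for N
    have y_Suc: "y (Suc N) = plane_act (rot_prod \<theta> P) (y N)" for N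
      by (simp add: y_def rot_prod_append plane_act_mult)
    have form_c1: "c1 * (cmod x)\<^sup>2 \<le> \<bar>form \<theta> x\<bar>" for x
    proof -
      have "c1 * (cmod x)\<^sup>2 \<le> (\<bar>Im (p \<theta>)\<bar> - cmod (q \<theta>)) * (cmod x)\<^sup>2"
        using bounds(1)[OF \<theta>] by (intro mult_right_mono) auto
      with form_ge[of \<theta> x] show ?thesis by linarith
    qed
    have form_c2: "\<bar>form \<theta> x\<bar> \<le> c2 * (cmod x)\<^sup>2" for x
    proof -
      have "(\<bar>Im (p \<theta>)\<bar> + cmod (q \<theta>)) * (cmod x)\<^sup>2 \<le> c2 * (cmod x)\<^sup>2"
        using bounds(2)[OF \<theta>] by (intro mult_right_mono) auto
      with form_le[of \<theta> x] show ?thesis by linarith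
    qed
    have main: "N * \<bar>form \<theta> (y N)\<bar> \<le> c2 * turn \<theta> (concat (replicate N P) @ w) z" for N
    proof (induction N)
      case 0
      show ?case using turn_nonneg[OF w] c2 by simp
    next
      case (Suc N)
      let ?rest = "concat (replicate N P) @ w"
      let ?d = "det (rot_prod \<theta> P)"
      have d: "?d > 0" by (rule det_rot_prod_pos[OF P(1)])
      have inv: "form \<theta> (y (Suc N)) = ?d * form \<theta> (y N)"
        unfolding y_Suc form_def by (rule Im_cnj_plane_act)
      have "\<bar>form \<theta> (y (Suc N))\<bar> \<le> c2 * turn \<theta> P (y N)"
      proof -
        have "(cmod (y (Suc N)))\<^sup>2 \<le> turn \<theta> P (y N)"
          unfolding y_Suc by (rule turn_ge[OF P])
        then have "c2 * (cmod (y (Suc N)))\<^sup>2 \<le> c2 * turn \<theta> P (y N)"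
          using c2 by (intro mult_left_mono) auto
        with form_c2[of "y (Suc N)"] show ?thesis by linarith
      qed
      moreover have "?d * (N * \<bar>form \<theta> (y N)\<bar>) \<le> ?d * (c2 * turn \<theta> ?rest z)"
        using Suc d by (intro mult_left_mono) auto
      moreover have "N * \<bar>form \<theta> (y (Suc N))\<bar> = ?d * (N * \<bar>form \<theta> (y N)\<bar>)"
        unfolding inv using d by (simp add: abs_mult)
      moreover have "turn \<theta> (concat (replicate (Suc N) P) @ w) z = turn \<theta> P (y N) + ?d * turn \<theta> ?rest z"
        unfolding replicate.simps concat.simps append_assoc turn_append[of \<theta> P] y_def ..
      then have "c2 * turn \<theta> (concat (replicate (Suc N) P) @ w) z =
          c2 * turn \<theta> P (y N) + ?d * (c2 * turn \<theta> ?rest z)"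
        by (simp only: distrib_left mult.left_commute)
      moreover have "Suc N * \<bar>form \<theta> (y (Suc N))\<bar> = \<bar>form \<theta> (y (Suc N))\<bar> + N * \<bar>form \<theta> (y (Suc N))\<bar>"
        by (simp add: algebra_simps)
      ultimately show ?case by linarith
    qed
    have "N * (c1 * (cmod (y N))\<^sup>2) \<le> N * \<bar>form \<theta> (y N)\<bar>"
      by (intro mult_left_mono form_c1) auto
    also note main[of N]
    finally show "N * (c1 / c2) * (cmod (plane_act (rot_prod \<theta> (concat (replicate N P) @ w)) z))\<^sup>2
         \<le> turn \<theta> (concat (replicate N P) @ w) z"
      using c2 unfolding y_def by (simp add: field_simps)
  qed
qed

section \<open>Harnack's inequality for functions omitting a segment\<close>

text \<open>
  Harnack's inequality between the centre and the circle of half the radius.  The Cayley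
  transform \<open>x \<mapsto> (x - h 0) / (x + cnj (h 0))\<close> maps the right half-plane to the unit disc and \<open>h 0\<close>
  to \<open>0\<close>, so the Schwarz lemma bounds its value at \<open>z0\<close> by \<open>1/2\<close>.
\<close>

lemma Harnack_half_radius:
  fixes h :: "complex \<Rightarrow> complex"
  assumes r: "r > 0" and holo: "h holomorphic_on ball 0 r"
    and pos: "\<And>z. z \<in> ball 0 r \<Longrightarrow> Re (h z) > 0"
    and z0: "cmod z0 = r / 2"
  shows "Re (h z0) \<le> 3 * Re (h 0)"
proof -
  define g where "g z = (h (of_real r * z) - h 0) / (h (of_real r * z) + cnj (h 0))" for z
  have in_ball: "of_real r * z \<in> ball 0 r" if "cmod z < 1" for z :: complex
    using that r by (simp add: norm_mult)
  have Re0: "Re (h 0) > 0" using pos[of 0] r by simp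
  have nz: "h (of_real r * z) + cnj (h 0) \<noteq> 0" if "cmod z < 1" for z
  proof
    assume "h (of_real r * z) + cnj (h 0) = 0"
    then have "Re (h (of_real r * z)) + Re (h 0) = 0"
      by (metis complex_cnj(1) plus_complex.simps(1) zero_complex.simps(1) complex.collapse complex.sel(1))
    with pos[OF in_ball[OF that]] Re0 show False by simp
  qed
  have "(h \<circ> (\<lambda>z. of_real r * z)) holomorphic_on ball 0 1"
    by (rule holomorphic_on_compose_gen[OF _ holo])
       (auto intro!: holomorphic_intros in_ball simp del: mem_ball)
  then have hr: "(\<lambda>z. h (of_real r * z)) holomorphic_on ball 0 1"
    by (simp add: o_def)
  have g_holo: "g holomorphic_on ball 0 1"
    unfolding g_def by (intro holomorphic_intros hr) (use nz in auto)
  have g_lt: "cmod (g z) < 1" if z: "cmod z < 1" for z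
  proof -
    have "Re (h (of_real r * z)) > 0" using pos[OF in_ball[OF z]] .
    then have "Re (h (of_real r * z)) * Re (h 0) > 0" using Re0 by simp
    then have "(cmod (h (of_real r * z) - h 0))\<^sup>2 < (cmod (h (of_real r * z) + cnj (h 0)))\<^sup>2"
      unfolding cmod_power2 by (simp add: power2_eq_square algebra_simps)
    then have "cmod (h (of_real r * z) - h 0) < cmod (h (of_real r * z) + cnj (h 0))"
      by (rule power_less_imp_less_base) simp
    then show ?thesis
      by (simp add: g_def norm_divide divide_less_eq_1)
  qed
  define z1 where "z1 = z0 / of_real r"
  have z1: "cmod z1 = 1 / 2" "of_real r * z1 = z0"
    using z0 r by (auto simp: z1_def norm_divide)
  have "cmod (g z1) \<le> cmod z1"
    by (rule Schwarz_Lemma(1)[OF g_holo _ g_lt]) (auto simp: z1 g_def)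
  then have "2 * cmod (h z0 - h 0) \<le> cmod (h z0 + cnj (h 0))"
    using nz[of z1] by (simp add: g_def z1 norm_divide divide_simps split: if_splits)
  then have "(2 * cmod (h z0 - h 0))\<^sup>2 \<le> (cmod (h z0 + cnj (h 0)))\<^sup>2"
    by (intro power_mono) auto
  then have "4 * ((Re (h z0) - Re (h 0))\<^sup>2 + (Im (h z0) - Im (h 0))\<^sup>2)
      \<le> (Re (h z0) + Re (h 0))\<^sup>2 + (Im (h z0) - Im (h 0))\<^sup>2"
    unfolding power_mult_distrib cmod_power2 by simp
  then have "4 * (Re (h z0) - Re (h 0))\<^sup>2 \<le> (Re (h z0) + Re (h 0))\<^sup>2"
    using zero_le_power2[of "Im (h z0) - Im (h 0)"] unfolding distrib_left by linarith
  then have "(2 * (Re (h z0) - Re (h 0)))\<^sup>2 \<le> (Re (h z0) + Re (h 0))\<^sup>2"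
    by (simp only: power_mult_distrib four_x_squared)
  moreover have "0 \<le> Re (h z0) + Re (h 0)" using pos[of z0] z0 r Re0 by simp
  ultimately have "2 * (Re (h z0) - Re (h 0)) \<le> Re (h z0) + Re (h 0)"
    by (rule power2_le_imp_le)
  then show ?thesis by simp
qed

text \<open>
  Outside the segment \<open>[-1, 1]\<close> the Joukowski map \<open>\<mu> \<mapsto> (\<mu> + 1/\<mu>) / 2\<close> has the inverse
  \<open>t \<mapsto> t (1 + csqrt (1 - 1/t\<^sup>2))\<close> with values of modulus greater than 1.  Composed with \<open>t\<close> it has a
  holomorphic logarithm with positive real part, to which Harnack's inequality applies; the factor
  3 becomes the exponent.
\<close>

lemma slit_avoiding_growth:
  fixes t :: "complex \<Rightarrow> complex"
  assumes r: "r > 0" and holo: "t holomorphic_on ball 0 r"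
    and avoid: "\<And>z. z \<in> ball 0 r \<Longrightarrow> t z \<notin> of_real ` {-1..1}"
    and z0: "cmod z0 = r / 2"
  shows "cmod (t z0) \<le> (2 * cmod (t 0) + 1) ^ 3"
proof -
  define s where "s z = csqrt (1 - 1 / (t z)\<^sup>2)" for z
  define \<mu> where "\<mu> z = t z * (1 + s z)" for z
  have nz: "t z \<noteq> 0" if "z \<in> ball 0 r" for z
    using avoid[OF that] by (auto simp: image_iff)
  have slit: "1 - 1 / (t z)\<^sup>2 \<notin> \<real>\<^sub>\<le>\<^sub>0" if z: "z \<in> ball 0 r" for z
  proof
    assume "1 - 1 / (t z)\<^sup>2 \<in> \<real>\<^sub>\<le>\<^sub>0"
    then obtain a where a: "1 - 1 / (t z)\<^sup>2 = of_real a" "a \<le> 0"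
      by (auto elim: nonpos_Reals_cases)
    then have "(t z)\<^sup>2 * (1 - of_real a) = 1" using nz[OF z]
      by (simp add: field_simps)
    then have "(t z)\<^sup>2 = of_real (1 / (1 - a))"
      using a(2) by (simp add: divide_simps)
    also have "\<dots> = (of_real (sqrt (1 / (1 - a))))\<^sup>2"
      using a(2) by (simp flip: of_real_power)
    finally have "t z = of_real (sqrt (1 / (1 - a))) \<or> t z = of_real (- sqrt (1 / (1 - a)))"
      by (simp add: power2_eq_iff)
    moreover have "sqrt (1 / (1 - a)) \<in> {-1..1}" "- sqrt (1 / (1 - a)) \<in> {-1..1}"
      using a(2) by (auto simp: divide_simps real_le_lsqrt intro: order_trans[of _ 0])
    ultimately show False using avoid[OF z] by blast
  qed
  have "s holomorphic_on ball 0 r"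
    unfolding s_def using slit nz by (intro holomorphic_intros holo) auto
  then have \<mu>_holo: "\<mu> holomorphic_on ball 0 r"
    unfolding \<mu>_def by (intro holomorphic_intros holo)
  have inv: "\<mu> z * (t z * (1 - s z)) = 1" if "z \<in> ball 0 r" for z
  proof -
    have "\<mu> z * (t z * (1 - s z)) = (t z)\<^sup>2 * (1 - (s z)\<^sup>2)"
      by (simp add: \<mu>_def power2_eq_square algebra_simps)
    also have "\<dots> = 1" using nz[OF that] by (simp add: s_def)
    finally show ?thesis .
  qed
  have Re_s: "Re (s z) > 0" if "z \<in> ball 0 r" for z
  proof -
    have "Re (s z) \<noteq> 0"
    proof
      assume "Re (s z) = 0"
      then have "(s z)\<^sup>2 = of_real (- (Im (s z))\<^sup>2)"
        by (simp add: complex_eq_iff power2_eq_square)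
      then have "1 - 1 / (t z)\<^sup>2 = of_real (- (Im (s z))\<^sup>2)"
        by (simp add: s_def)
      with slit[OF that] show False
        by (metis neg_le_0_iff_le nonpos_Reals_of_real_iff zero_le_power2)
    qed
    with csqrt_principal[of "1 - 1 / (t z)\<^sup>2"] show ?thesis
      by (auto simp: s_def)
  qed
  have \<mu>_gt: "cmod (\<mu> z) > 1" if z: "z \<in> ball 0 r" for z
  proof -
    have "(cmod (1 - s z))\<^sup>2 < (cmod (1 + s z))\<^sup>2"
      unfolding cmod_power2 using Re_s[OF z] by (simp add: power2_eq_square algebra_simps)
    then have "cmod (1 - s z) < cmod (1 + s z)"
      by (rule power_less_imp_less_base) simp
    then have lt: "cmod (t z * (1 - s z)) < cmod (\<mu> z)"
      using nz[OF z] by (simp add: \<mu>_def norm_mult)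
    have one: "cmod (\<mu> z) * cmod (t z * (1 - s z)) = 1"
      using inv[OF z] by (metis norm_mult norm_one)
    show ?thesis
    proof (rule ccontr)
      assume *: "\<not> ?thesis"
      with lt have "cmod (\<mu> z) * cmod (t z * (1 - s z)) \<le> 1 * cmod (t z * (1 - s z))"
        by (intro mult_right_mono) auto
      with lt * one show False by simp
    qed
  qed
  have "contractible (ball (0::complex) r)"
    by (simp add: convex_imp_contractible)
  then obtain h where h: "h holomorphic_on ball 0 r" "\<And>z. z \<in> ball 0 r \<Longrightarrow> \<mu> z = exp (h z)"
    using contractible_imp_holomorphic_log[OF \<mu>_holo, of thesis] \<mu>_gt by force
  have Re_h: "cmod (\<mu> z) = exp (Re (h z))" if "z \<in> ball 0 r" for z
    using h(2)[OF that] by simp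
  have "Re (h z0) \<le> 3 * Re (h 0)"
  proof (rule Harnack_half_radius[OF r h(1) _ z0])
    show "Re (h z) > 0" if "z \<in> ball 0 r" for z
      using \<mu>_gt[OF that] Re_h[OF that] by simp
  qed
  then have "exp (Re (h z0)) \<le> exp (Re (h 0)) ^ 3"
    by (simp flip: exp_of_nat_mult)
  moreover have in0: "(0::complex) \<in> ball 0 r" "z0 \<in> ball 0 r" using r z0 by auto
  ultimately have *: "cmod (\<mu> z0) \<le> cmod (\<mu> 0) ^ 3"
    using Re_h by simp
  have "cmod 1 \<le> cmod (1 + s z0)"
    using Re_s[OF in0(2)] complex_Re_le_cmod[of "1 + s z0"] by simp
  then have "cmod (t z0) * 1 \<le> cmod (t z0) * cmod (1 + s z0)"
    by (intro mult_left_mono) auto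
  then have 1: "cmod (t z0) \<le> cmod (\<mu> z0)"
    by (simp add: \<mu>_def norm_mult)
  have "cmod (\<mu> 0) * cmod (t 0 * (1 - s 0)) = 1"
    using inv[OF in0(1)] by (metis norm_mult norm_one)
  with \<mu>_gt[OF in0(1)] have "cmod (t 0 * (1 - s 0)) \<le> 1"
    by (smt (verit) mult_less_cancel_right1 norm_ge_zero)
  moreover have "\<mu> 0 = 2 * t 0 - t 0 * (1 - s 0)"
    by (simp add: \<mu>_def algebra_simps)
  then have "cmod (\<mu> 0) \<le> cmod (2 * t 0) + cmod (t 0 * (1 - s 0))"
    by (metis norm_triangle_ineq4)
  ultimately have "cmod (\<mu> 0) \<le> 2 * cmod (t 0) + 1"
    by (simp add: norm_mult)
  then have "cmod (\<mu> 0) ^ 3 \<le> (2 * cmod (t 0) + 1) ^ 3"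
    by (intro power_mono) auto
  with 1 * show ?thesis by linarith
qed

section \<open>Complex rotation angles and domination\<close>

text \<open>
  The complexification of a real matrix, written in the basis where it acts on the pairs
  \<open>(z, cnj z)\<close>.  Rotations become diagonal there and continue to complex angles.
\<close>

definition complexification :: "real ^ 2 ^ 2 \<Rightarrow> complex ^ 2 ^ 2" where
  "complexification X = vector [vector [hol_part X, antihol_part X],
                        vector [cnj (antihol_part X), cnj (hol_part X)]]"

definition complex_rotation :: "complex \<Rightarrow> complex ^ 2 ^ 2" where
  "complex_rotation \<zeta> = vector [vector [exp (\<i> * \<zeta>), 0], vector [0, exp (- (\<i> * \<zeta>))]]"

primrec complex_rot_prod :: "complex \<Rightarrow> (real ^ 2 ^ 2) list \<Rightarrow> complex ^ 2 ^ 2" where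
  "complex_rot_prod \<zeta> [] = mat 1"
| "complex_rot_prod \<zeta> (X # w) = complex_rotation \<zeta> ** complexification X ** complex_rot_prod \<zeta> w"

lemma complexification_nth [simp]:
  "complexification X $ 1 $ 1 = hol_part X" "complexification X $ 1 $ 2 = antihol_part X"
  "complexification X $ 2 $ 1 = cnj (antihol_part X)" "complexification X $ 2 $ 2 = cnj (hol_part X)"
  by (simp_all add: complexification_def)

lemma complex_rotation_nth [simp]:
  "complex_rotation \<zeta> $ 1 $ 1 = exp (\<i> * \<zeta>)" "complex_rotation \<zeta> $ 1 $ 2 = 0"
  "complex_rotation \<zeta> $ 2 $ 1 = 0" "complex_rotation \<zeta> $ 2 $ 2 = exp (- (\<i> * \<zeta>))"
  by (simp_all add: complex_rotation_def)

lemma complex_rot_prod_Cons_nth: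
  fixes w :: "(real ^ 2 ^ 2) list" and \<zeta> :: complex
  defines "M \<equiv> complex_rot_prod \<zeta> w"
  shows "complex_rot_prod \<zeta> (X # w) $ 1 $ j = exp (\<i> * \<zeta>) * (hol_part X * M $ 1 $ j + antihol_part X * M $ 2 $ j)"
    "complex_rot_prod \<zeta> (X # w) $ 2 $ j =
       exp (- (\<i> * \<zeta>)) * (cnj (antihol_part X) * M $ 1 $ j + cnj (hol_part X) * M $ 2 $ j)"
  by (simp_all add: matrix_matrix_mult_def sum_2 M_def algebra_simps)

lemma complexification_mult: "complexification (X ** Y) = complexification X ** complexification Y"
  by (simp add: vec_eq_iff forall_2 matrix_matrix_mult_def[of "complexification X"] sum_2 parts_mult)

lemma complex_rot_prod_of_real: "complex_rot_prod (of_real \<theta>) w = complexification (rot_prod \<theta> w)"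
proof (induction w)
  case Nil
  show ?case by (simp add: vec_eq_iff forall_2 mat_def[of "1 :: complex"])
next
  case (Cons X w)
  have "complex_rotation (of_real \<theta>) = complexification (rotation_mat \<theta>)"
    by (simp add: vec_eq_iff forall_2 cis_conv_exp exp_cnj)
  with Cons show ?case by (simp add: complexification_mult)
qed

lemma trace_complex_rot_prod_of_real:
  "trace (complex_rot_prod (of_real \<theta>) w) = of_real (trace (rot_prod \<theta> w))"
  by (simp add: complex_rot_prod_of_real trace_2[of "complexification _"] trace_eq_hol_part complex_add_cnj)

lemma det_complex_rot_prod: "det (complex_rot_prod \<zeta> w) = of_real (prod_list (map det w))"
proof (induction w)
  case (Cons X w)
  have "det (complexification X) = of_real (det X)"
    unfolding det_eq_parts of_real_diff complex_norm_square by (simp add: det_2)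
  moreover have "det (complex_rotation \<zeta>) = 1"
    by (simp add: det_2 flip: exp_add)
  ultimately show ?case using Cons by (simp add: det_mul)
qed simp

lemma holomorphic_complex_rot_prod:
  "(\<lambda>\<zeta>. complex_rot_prod \<zeta> w $ 1 $ j) holomorphic_on S"
  "(\<lambda>\<zeta>. complex_rot_prod \<zeta> w $ 2 $ j) holomorphic_on S"
proof (induction w)
  case (Cons X w)
  { case 1 show ?case unfolding complex_rot_prod_Cons_nth by (intro holomorphic_intros Cons)
  next
    case 2 show ?case unfolding complex_rot_prod_Cons_nth by (intro holomorphic_intros Cons) }
qed auto

lemma complex_rot_prod_cnj:
  "complex_rot_prod (cnj \<zeta>) w $ 1 $ 1 = cnj (complex_rot_prod \<zeta> w $ 2 $ 2)"
  "complex_rot_prod (cnj \<zeta>) w $ 1 $ 2 = cnj (complex_rot_prod \<zeta> w $ 2 $ 1)"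
  "complex_rot_prod (cnj \<zeta>) w $ 2 $ 1 = cnj (complex_rot_prod \<zeta> w $ 1 $ 2)"
  "complex_rot_prod (cnj \<zeta>) w $ 2 $ 2 = cnj (complex_rot_prod \<zeta> w $ 1 $ 1)"
proof (induction w)
  case Nil
  { case 1 show ?case by (simp add: mat_def) next case 2 show ?case by (simp add: mat_def)
  next case 3 show ?case by (simp add: mat_def) next case 4 show ?case by (simp add: mat_def) }
next
  case (Cons X w)
  { case 1 show ?case unfolding complex_rot_prod_Cons_nth using Cons by (simp add: exp_cnj add.commute)
  next case 2 show ?case unfolding complex_rot_prod_Cons_nth using Cons by (simp add: exp_cnj add.commute)
  next case 3 show ?case unfolding complex_rot_prod_Cons_nth using Cons by (simp add: exp_cnj add.commute)
  next case 4 show ?case unfolding complex_rot_prod_Cons_nth using Cons by (simp add: exp_cnj add.commute) }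
qed

text \<open>
  This symmetry reduces angles in the upper half-plane to angles in the lower one.
\<close>

lemma trace_complex_rot_prod_cnj:
  "trace (complex_rot_prod (cnj \<zeta>) w) = cnj (trace (complex_rot_prod \<zeta> w))"
  by (simp add: trace_2 complex_rot_prod_cnj)

text \<open>
  Matrices of positive determinant preserve the cone \<open>\<bar>y\<bar> \<le> \<bar>x\<bar>\<close> and scale its Hermitian form.
\<close>

lemma Hermitian_form_complexification:
  "(cmod (hol_part X * x + antihol_part X * y))\<^sup>2 - (cmod (cnj (antihol_part X) * x + cnj (hol_part X) * y))\<^sup>2
     = det X * ((cmod x)\<^sup>2 - (cmod y)\<^sup>2)"
  unfolding det_eq_parts cmod_power2 by (simp add: power2_eq_square algebra_simps)

text \<open>
  A rotation through an angle with imaginary part \<open>-s\<close> multiplies \<open>\<bar>x\<bar>\<close> by \<open>exp s\<close> and \<open>\<bar>y\<bar>\<close> by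
  \<open>exp (-s)\<close>, so on the cone the Hermitian form gains at least the factor \<open>exp (2 s)\<close> per letter,
  and the image lies in a narrower cone.  The second statement excludes eigenvectors on the
  boundary of the cone.
\<close>

lemma complex_rot_prod_cone:
  fixes x y \<zeta> :: complex
  defines "u w \<equiv> complex_rot_prod \<zeta> w $ 1 $ 1 * x + complex_rot_prod \<zeta> w $ 1 $ 2 * y"
    and "v w \<equiv> complex_rot_prod \<zeta> w $ 2 $ 1 * x + complex_rot_prod \<zeta> w $ 2 $ 2 * y"
  assumes s: "Im \<zeta> = - s" "s \<ge> 0" and w: "set w \<subseteq> GL2_plus" and cone: "cmod y \<le> cmod x"
  shows "exp (2 * s * length w) * prod_list (map det w) * ((cmod x)\<^sup>2 - (cmod y)\<^sup>2)
           \<le> (cmod (u w))\<^sup>2 - (cmod (v w))\<^sup>2"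
    and "w \<noteq> [] \<Longrightarrow> cmod (v w) \<le> exp (- (2 * s)) * cmod (u w)"
  using w
proof (induction w)
  case Nil
  { case 1 show ?case by (simp add: u_def v_def mat_def)
  next case 2 then show ?case by simp }
next
  case (Cons X w)
  define x' where "x' = hol_part X * u w + antihol_part X * v w"
  define y' where "y' = cnj (antihol_part X) * u w + cnj (hol_part X) * v w"
  have uv: "u (X # w) = exp (\<i> * \<zeta>) * x'" "v (X # w) = exp (- (\<i> * \<zeta>)) * y'"
    unfolding u_def v_def x'_def y'_def complex_rot_prod_Cons_nth by (simp_all add: algebra_simps)
  have norm_uv: "cmod (u (X # w)) = exp s * cmod x'" "cmod (v (X # w)) = exp (- s) * cmod y'"
    unfolding uv by (simp_all add: norm_mult s)
  have det0: "0 \<le> exp (2 * s * length w) * prod_list (map det w)"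
    if "set w \<subseteq> GL2_plus"
    using det_rot_prod_pos[OF that, of 0] by (simp add: det_rot_prod)
  have X: "det X > 0" and w: "set w \<subseteq> GL2_plus" if "set (X # w) \<subseteq> GL2_plus"
    using that by (auto simp: GL2_plus_def)
  have form: "(cmod x')\<^sup>2 - (cmod y')\<^sup>2 = det X * ((cmod (u w))\<^sup>2 - (cmod (v w))\<^sup>2)"
    unfolding x'_def y'_def by (rule Hermitian_form_complexification)
  have Qxy: "0 \<le> (cmod x)\<^sup>2 - (cmod y)\<^sup>2" using cone by (simp add: power_mono)
  have Q': "exp (2 * s * length w) * prod_list (map det (X # w)) * ((cmod x)\<^sup>2 - (cmod y)\<^sup>2)
      \<le> (cmod x')\<^sup>2 - (cmod y')\<^sup>2" if "set (X # w) \<subseteq> GL2_plus"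
  proof -
    have "det X * (exp (2 * s * length w) * prod_list (map det w) * ((cmod x)\<^sup>2 - (cmod y)\<^sup>2))
        \<le> det X * ((cmod (u w))\<^sup>2 - (cmod (v w))\<^sup>2)"
      using Cons.IH(1)[OF w[OF that]] X[OF that] by (intro mult_left_mono) auto
    then show ?thesis unfolding form by (simp add: mult_ac)
  qed
  have cone': "cmod y' \<le> cmod x'" if "set (X # w) \<subseteq> GL2_plus"
  proof -
    have "0 \<le> exp (2 * s * length w) * prod_list (map det (X # w)) * ((cmod x)\<^sup>2 - (cmod y)\<^sup>2)"
      using det0[OF w[OF that]] X[OF that] Qxy by (simp add: zero_le_mult_iff)
    with Q'[OF that] have "(cmod y')\<^sup>2 \<le> (cmod x')\<^sup>2" by linarith
    then show ?thesis by (rule power2_le_imp_le) simp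
  qed
  { case 1
    have e: "exp (2 * s) = (exp s)\<^sup>2" "exp (- s) \<le> exp s"
      using s by (simp_all flip: exp_of_nat_mult)
    have "exp (2 * s) * (exp (2 * s * length w) * prod_list (map det (X # w)) * ((cmod x)\<^sup>2 - (cmod y)\<^sup>2))
        \<le> (exp s)\<^sup>2 * ((cmod x')\<^sup>2 - (cmod y')\<^sup>2)"
      unfolding e(1) by (rule mult_left_mono[OF Q'[OF 1]]) simp
    also have "\<dots> \<le> (exp s)\<^sup>2 * (cmod x')\<^sup>2 - (exp (- s))\<^sup>2 * (cmod y')\<^sup>2"
      using e(2) by (simp add: right_diff_distrib mult_right_mono)
    also have "\<dots> = (cmod (u (X # w)))\<^sup>2 - (cmod (v (X # w)))\<^sup>2"
      unfolding norm_uv power_mult_distrib ..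
    also have "exp (2 * s) * (exp (2 * s * length w) * prod_list (map det (X # w)) * ((cmod x)\<^sup>2 - (cmod y)\<^sup>2))
      = exp (2 * s * length (X # w)) * prod_list (map det (X # w)) * ((cmod x)\<^sup>2 - (cmod y)\<^sup>2)"
      by (simp add: distrib_left exp_add mult_ac)
    finally show ?case .
  next
    case 2
    have "exp (- s) * cmod y' \<le> exp (- s) * cmod x'"
      by (intro mult_left_mono cone' 2) simp
    also have "\<dots> = exp (- (2 * s)) * (exp s * cmod x')"
      by (simp flip: exp_add mult.assoc)
    finally show ?case unfolding norm_uv .
  }
qed

text \<open>
  The projective action maps the closed unit disc of slopes \<open>y / x\<close> into itself, so Brouwer's theorem
  provides an eigenvector in the cone.  There the growth of the Hermitian form is the growth
  of \<open>\<bar>\<mu>\<bar>\<^sup>2\<close>.  The other eigenvalue is \<open>\<delta> / \<mu>\<close>.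
\<close>

lemma complex_rot_prod_eigenvalue:
  assumes s: "Im \<zeta> = - s" "s > 0" and w: "set w \<subseteq> GL2_plus" "w \<noteq> []"
  defines "\<delta> \<equiv> prod_list (map det w)"
  obtains \<mu> where "trace (complex_rot_prod \<zeta> w) = \<mu> + of_real \<delta> / \<mu>"
    "exp (2 * s * length w) * \<delta> \<le> (cmod \<mu>)\<^sup>2"
proof -
  have \<delta>: "\<delta> > 0" using det_rot_prod_pos[OF w(1), of 0] by (simp add: det_rot_prod \<delta>_def)
  define a b c d where "a = complex_rot_prod \<zeta> w $ 1 $ 1" and "b = complex_rot_prod \<zeta> w $ 1 $ 2"
    and "c = complex_rot_prod \<zeta> w $ 2 $ 1" and "d = complex_rot_prod \<zeta> w $ 2 $ 2"
  have det: "a * d - b * c = of_real \<delta>"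
    using det_complex_rot_prod[of \<zeta> w] by (simp add: det_2 a_def b_def c_def d_def \<delta>_def)
  have growth: "exp (2 * s * length w) * \<delta> * (1 - (cmod z)\<^sup>2) \<le> (cmod (a + b * z))\<^sup>2 - (cmod (c + d * z))\<^sup>2"
    and contr: "cmod (c + d * z) \<le> exp (- (2 * s)) * cmod (a + b * z)" if "cmod z \<le> 1" for z
    using complex_rot_prod_cone[of \<zeta> s w z 1] that s w by (simp_all add: a_def b_def c_def d_def \<delta>_def)
  have shrink: "exp (- (2 * s)) < 1" using s by simp
  have le: "cmod (c + d * z) \<le> cmod (a + b * z)" if "cmod z \<le> 1" for z
    using contr[OF that] mult_right_mono[of "exp (- (2 * s))" 1 "cmod (a + b * z)"] shrink by simp
  have nz: "a + b * z \<noteq> 0" if "cmod z \<le> 1" for z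
  proof
    assume *: "a + b * z = 0"
    with le[OF that] have "c + d * z = 0" by simp
    with * have "a = - b * z" "c = - d * z" by (simp_all add: eq_neg_iff_add_eq_0)
    then have "a * d - b * c = 0" by simp
    with det \<delta> show False by simp
  qed
  obtain z where z: "cmod z \<le> 1" "(c + d * z) / (a + b * z) = z"
  proof (rule brouwer_ball[of 1 0 "\<lambda>z. (c + d * z) / (a + b * z)"])
    show "continuous_on (cball 0 1) (\<lambda>z. (c + d * z) / (a + b * z))"
      using nz by (intro continuous_intros) auto
    show "(\<lambda>z. (c + d * z) / (a + b * z)) \<in> cball 0 1 \<rightarrow> cball 0 1"
      using nz le by (auto simp: norm_divide divide_le_eq_1)
  qed (auto simp: that)
  define \<mu> where "\<mu> = a + b * z"
  have \<mu>: "\<mu> \<noteq> 0" "c + d * z = \<mu> * z" using nz[OF z(1)] z(2) by (auto simp: \<mu>_def field_simps)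
  \<comment> \<open>The characteristic equation of the eigenvalue \<open>\<mu>\<close>.\<close>
  have "\<mu> * \<mu> + (a * d - b * c) = (a + d) * \<mu>"
    using \<mu>(2) unfolding \<mu>_def by algebra
  then have tr: "trace (complex_rot_prod \<zeta> w) = \<mu> + of_real \<delta> / \<mu>"
    using \<mu>(1) unfolding det by (simp add: trace_2 a_def d_def field_simps)
  have "cmod \<mu> * cmod z \<le> exp (- (2 * s)) * cmod \<mu>"
    using contr[OF z(1)] unfolding \<mu>(2) norm_mult by (simp add: \<mu>_def)
  then have "cmod z \<le> exp (- (2 * s))" using \<mu>(1) by (simp add: mult.commute[of "exp _"])
  with shrink have "cmod z < 1" by linarith
  then have pos: "1 - (cmod z)\<^sup>2 > 0" by (simp add: power_less_one_iff)
  have "exp (2 * s * length w) * \<delta> * (1 - (cmod z)\<^sup>2) \<le> (cmod \<mu>)\<^sup>2 * (1 - (cmod z)\<^sup>2)"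
    using growth[OF z(1)] unfolding \<mu>(2) norm_mult
    by (simp add: \<mu>_def power_mult_distrib right_diff_distrib)
  then have "exp (2 * s * length w) * \<delta> \<le> (cmod \<mu>)\<^sup>2"
    using pos by (rule mult_right_le_imp_le)
  with tr show ?thesis by (rule that)
qed

text \<open>
  If the trace is real although \<open>\<bar>\<mu>\<bar>\<^sup>2 > \<delta>\<close>, then \<open>\<mu>\<close> is real, since nonreal eigenvalues
  would be conjugate and of equal modulus.  Then \<open>r\<^sup>2 \<ge> 4 \<delta>\<close>; the weaker bound stated matches the
  condition \<open>(trace)\<^sup>2 > det\<close> used at real angles.
\<close>

lemma trace_complex_rot_prod_not_small_real:
  assumes \<zeta>: "Im \<zeta> \<noteq> 0" and w: "set w \<subseteq> GL2_plus" "w \<noteq> []"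
    and r: "trace (complex_rot_prod \<zeta> w) = of_real r"
  shows "r\<^sup>2 > prod_list (map det w)"
proof -
  define \<delta> where "\<delta> = prod_list (map det w)"
  have \<delta>: "\<delta> > 0" using det_rot_prod_pos[OF w(1), of 0] by (simp add: det_rot_prod \<delta>_def)
  have *: "r\<^sup>2 > \<delta>" if \<zeta>: "Im \<zeta> < 0" and r: "trace (complex_rot_prod \<zeta> w) = of_real r" for \<zeta>
  proof -
    obtain \<mu> where \<mu>: "trace (complex_rot_prod \<zeta> w) = \<mu> + of_real \<delta> / \<mu>"
      "exp (2 * (- Im \<zeta>) * length w) * \<delta> \<le> (cmod \<mu>)\<^sup>2"
      using complex_rot_prod_eigenvalue[of \<zeta> "- Im \<zeta>" w] \<zeta> w unfolding \<delta>_def by auto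
    have "exp (2 * (- Im \<zeta>) * length w) > 1" using \<zeta> w by (simp add: mult_neg_pos)
    then have "1 * \<delta> < exp (2 * (- Im \<zeta>) * length w) * \<delta>"
      using \<delta> by (intro mult_strict_right_mono)
    with \<mu>(2) have gt: "\<delta> < (cmod \<mu>)\<^sup>2" by linarith
    then have nz: "\<mu> \<noteq> 0" using \<delta> by auto
    have "of_real \<delta> / \<mu> = of_real (\<delta> / (cmod \<mu>)\<^sup>2) * cnj \<mu>"
      using nz unfolding of_real_divide complex_norm_square by (simp add: field_simps)
    then have eq: "of_real r = \<mu> + of_real (\<delta> / (cmod \<mu>)\<^sup>2) * cnj \<mu>"
      using \<mu>(1) r by simp
    have "(cmod \<mu>)\<^sup>2 > 0" using nz by simp
    then have "\<delta> / (cmod \<mu>)\<^sup>2 < 1" using gt by (simp only: pos_divide_less_eq mult_1_left)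
    moreover have "Im \<mu> * (1 - \<delta> / (cmod \<mu>)\<^sup>2) = 0"
      using arg_cong[OF eq, of Im] by (simp add: algebra_simps)
    ultimately have "Im \<mu> = 0" by (metis diff_gt_0_iff_gt less_irrefl mult_eq_0_iff)
    define x where "x = Re \<mu>"
    have x: "\<mu> = of_real x" using \<open>Im \<mu> = 0\<close> by (simp add: complex_eq_iff x_def)
    then have "x \<noteq> 0" using nz by auto
    have "of_real r = (of_real (x + \<delta> / x) :: complex)"
      using \<mu>(1) r unfolding x by simp
    then have "r = x + \<delta> / x" by (simp only: of_real_eq_iff)
    then have "r\<^sup>2 = x\<^sup>2 + 2 * \<delta> + (\<delta> / x)\<^sup>2"
      using \<open>x \<noteq> 0\<close> by (simp add: power2_sum)
    moreover have "(\<delta> / x)\<^sup>2 \<ge> 0" "x\<^sup>2 \<ge> 0" by simp_all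
    ultimately show ?thesis using \<delta> by linarith
  qed
  show ?thesis
  proof (cases "Im \<zeta> < 0")
    case True
    then show ?thesis using * r by (simp add: \<delta>_def)
  next
    case False
    then show ?thesis using *[of "cnj \<zeta>"] r \<zeta> by (simp add: \<delta>_def trace_complex_rot_prod_cnj)
  qed
qed

lemma trace_complex_rot_prod_ge:
  assumes s: "Im \<zeta> = - s" "s > 0" and w: "set w \<subseteq> GL2_plus" "w \<noteq> []"
  defines "\<delta> \<equiv> prod_list (map det w)"
  shows "sqrt \<delta> * (exp (s * length w) * (1 - exp (- (2 * s)))) \<le> cmod (trace (complex_rot_prod \<zeta> w))"
proof -
  have \<delta>: "\<delta> > 0" using det_rot_prod_pos[OF w(1), of 0] by (simp add: det_rot_prod \<delta>_def)
  obtain \<mu> where \<mu>: "trace (complex_rot_prod \<zeta> w) = \<mu> + of_real \<delta> / \<mu>"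
    "exp (2 * s * length w) * \<delta> \<le> (cmod \<mu>)\<^sup>2"
    using complex_rot_prod_eigenvalue[OF s w] unfolding \<delta>_def by blast
  define m where "m = exp (s * length w) * sqrt \<delta>"
  have m0: "m > 0" using \<delta> by (simp add: m_def)
  have m2: "m\<^sup>2 = exp (2 * s * length w) * \<delta>"
    using \<delta> by (simp add: m_def power_mult_distrib flip: exp_of_nat_mult)
  have m: "m \<le> cmod \<mu>" by (rule power2_le_imp_le) (use \<mu>(2) m2 in auto)
  have "exp (- (2 * s)) * m\<^sup>2 \<ge> \<delta>"
  proof -
    have "2 * s * 1 \<le> 2 * s * length w"
      using s w by (intro mult_left_mono) (auto simp: Suc_le_eq)
    then have "exp 0 \<le> exp (- (2 * s) + 2 * s * length w)" by (simp only: exp_le_cancel_iff)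
    then have "1 * \<delta> \<le> exp (- (2 * s) + 2 * s * length w) * \<delta>"
      using \<delta> by (intro mult_right_mono) auto
    then show ?thesis unfolding m2 by (simp only: exp_add mult.assoc mult_1_left)
  qed
  then have "\<delta> / m \<le> exp (- (2 * s)) * m"
    using m0 by (simp add: divide_le_eq power2_eq_square mult_ac)
  moreover have "cmod \<mu> > 0" using m m0 by linarith
  then have "\<delta> / cmod \<mu> \<le> \<delta> / m"
    using m m0 \<delta> by (intro divide_left_mono mult_pos_pos) auto
  moreover have "cmod \<mu> - cmod (of_real \<delta> / \<mu>) \<le> cmod (\<mu> + of_real \<delta> / \<mu>)"
    by (metis norm_diff_ineq)
  ultimately have "m - exp (- (2 * s)) * m \<le> cmod (trace (complex_rot_prod \<zeta> w))"
    using m \<delta> unfolding \<mu>(1) by (simp add: norm_divide)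
  then show ?thesis by (simp add: m_def algebra_simps)
qed

lemma rot_prod_0: "rot_prod 0 w = foldr (**) w (mat 1)"
  by (induction w) simp_all

text \<open>
  Asking for \<open>(trace)\<^sup>2 > det\<close> rather than for the hyperbolicity condition \<open>(trace)\<^sup>2 > 4 det\<close> avoids
  parabolic products: a violation is elliptic with room to spare, while the normalised trace
  still omits a whole segment.
\<close>

lemma dominated_if_no_elliptic_products:
  fixes A :: "(real ^ 2 ^ 2) set"
  assumes A: "A \<subseteq> GL2_plus" and \<eta>: "\<eta> > 0"
    and hyp: "\<And>w \<theta>. set w \<subseteq> A \<Longrightarrow> w \<noteq> [] \<Longrightarrow> \<bar>\<theta>\<bar> < \<eta> \<Longrightarrow>
      (trace (rot_prod \<theta> w))\<^sup>2 > det (rot_prod \<theta> w)"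
  shows "dominated 1 A"
proof -
  \<comment> \<open>\<open>-i s\<close> lies on the circle of half the radius; 27 comes from \<open>2 T + 1 \<le> 3 T\<close> for the
    normalised trace \<open>T > 1\<close>, cubed.\<close>
  define s where "s = \<eta> / 2"
  define k where "k = root 3 ((1 - exp (- (2 * s))) / 27)"
  define \<tau> where "\<tau> = exp (- (2 * s / 3))"
  have s: "s > 0" using \<eta> by (simp add: s_def)
  have k: "k > 0" using s by (simp add: k_def)
  have \<tau>: "\<tau> \<in> {0<..<1}" using s by (simp add: \<tau>_def)
  have "singular_value 2 M / singular_value 1 M \<le> max 2 (4 / k\<^sup>2) * \<tau> ^ length w"
    if w: "set w \<subseteq> A" "w \<noteq> []" and M: "M = foldr (**) w (mat 1)" for w M
  proof -
    define \<delta> where "\<delta> = prod_list (map det w)"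
    define t where "t \<zeta> = trace (complex_rot_prod \<zeta> w) / of_real (sqrt \<delta>)" for \<zeta>
    have wG: "set w \<subseteq> GL2_plus" using w A by blast
    have \<delta>: "\<delta> > 0" using det_rot_prod_pos[OF wG, of 0] by (simp add: det_rot_prod \<delta>_def)
    have holo: "t holomorphic_on ball 0 \<eta>"
      unfolding t_def trace_2 using \<delta>
      by (intro holomorphic_intros holomorphic_complex_rot_prod) auto
    have avoid: "t \<zeta> \<notin> of_real ` {-1..1}" if \<zeta>: "\<zeta> \<in> ball 0 \<eta>" for \<zeta>
    proof
      assume "t \<zeta> \<in> of_real ` {-1..1}"
      then obtain x where x: "t \<zeta> = of_real x" "\<bar>x\<bar> \<le> 1" by auto
      define r where "r = sqrt \<delta> * x"
      have r: "trace (complex_rot_prod \<zeta> w) = of_real r"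
        using x(1) \<delta> by (simp add: t_def r_def field_simps)
      have "r\<^sup>2 \<le> \<delta>"
        using x(2) \<delta> by (simp add: r_def power_mult_distrib mult_left_le abs_square_le_1)
      moreover have "r\<^sup>2 > \<delta>"
      proof (cases "Im \<zeta> = 0")
        case False
        show ?thesis
          unfolding \<delta>_def by (rule trace_complex_rot_prod_not_small_real[OF False wG w(2) r])
      next
        case True
        then have "\<zeta> = of_real (Re \<zeta>)" by (simp add: complex_eq_iff)
        then have tr: "trace (rot_prod (Re \<zeta>) w) = r"
          using r trace_complex_rot_prod_of_real[of "Re \<zeta>" w] by simp
        have "\<bar>Re \<zeta>\<bar> < \<eta>" using \<zeta> abs_Re_le_cmod[of \<zeta>] by simp
        from hyp[OF w this] show ?thesis by (simp add: tr det_rot_prod \<delta>_def)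
      qed
      ultimately show False by simp
    qed
    define T where "T = \<bar>trace M\<bar> / sqrt \<delta>"
    have t0: "t 0 = of_real (trace M / sqrt \<delta>)"
      using trace_complex_rot_prod_of_real[of 0 w] by (simp add: t_def M rot_prod_0)
    then have T: "cmod (t 0) = T" using \<delta> by (simp add: T_def norm_divide)
    have "trace M / sqrt \<delta> \<notin> {-1..1}"
      using avoid[of 0] \<eta> imageI[of "trace M / sqrt \<delta>" "{-1..1}" complex_of_real] unfolding t0 by fastforce
    then have T1: "T > 1" using \<delta> by (auto simp: T_def abs_if field_simps split: if_splits)
    have *: "cmod (t (- (\<i> * of_real s))) \<le> (2 * cmod (t 0) + 1) ^ 3"
      by (rule slit_avoiding_growth[OF \<eta> holo avoid]) (use \<eta> in \<open>auto simp: norm_mult s_def\<close>)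
    have "sqrt \<delta> * (exp (s * length w) * (1 - exp (- (2 * s)))) \<le>
        cmod (trace (complex_rot_prod (- (\<i> * of_real s)) w))"
      unfolding \<delta>_def by (rule trace_complex_rot_prod_ge[OF _ s wG w(2)]) simp
    then have "exp (s * length w) * (1 - exp (- (2 * s))) \<le> cmod (t (- (\<i> * of_real s)))"
      using \<delta> by (simp add: t_def norm_divide pos_le_divide_eq mult.commute)
    also note *
    also have "(2 * cmod (t 0) + 1) ^ 3 \<le> (3 * T) ^ 3"
      using T1 unfolding T by (intro power_mono) auto
    finally have "exp (s * length w) * (1 - exp (- (2 * s))) \<le> 27 * T ^ 3"
      by (simp add: power_mult_distrib)
    moreover have "(k * exp (s * length w / 3)) ^ 3 = (1 - exp (- (2 * s))) / 27 * exp (s * length w)"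
      using s by (simp add: power_mult_distrib k_def flip: exp_of_nat_mult)
    ultimately have "(k * exp (s * length w / 3)) ^ 3 \<le> T ^ 3" by (simp add: mult.commute)
    then have "k * exp (s * length w / 3) \<le> T"
      using T1 by (simp add: power_mono_iff k less_imp_le)
    then have "(k * exp (s * length w / 3))\<^sup>2 \<le> T\<^sup>2"
      using k by (intro power_mono) auto
    also have "(k * exp (s * length w / 3))\<^sup>2 = k\<^sup>2 / \<tau> ^ length w"
    proof -
      have "(exp (s * length w / 3))\<^sup>2 * \<tau> ^ length w = 1"
        by (simp add: \<tau>_def flip: exp_of_nat_mult exp_add)
      then show ?thesis using \<tau> by (simp add: power_mult_distrib field_simps)
    qed
    finally have T2: "k\<^sup>2 / \<tau> ^ length w \<le> T\<^sup>2" .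
    have det_M: "det M = \<delta>" unfolding M rot_prod_0[symmetric] \<delta>_def by (rule det_rot_prod)
    have "trace M \<noteq> 0" using T1 by (auto simp: T_def)
    then have "singular_value 2 M / singular_value 1 M \<le> 4 * \<delta> / (trace M)\<^sup>2"
      using singular_value_ratio_le[of M] \<delta> det_M by simp
    also have "\<dots> = 4 / T\<^sup>2" using \<delta> by (simp add: T_def power_divide)
    also have "\<dots> \<le> 4 / (k\<^sup>2 / \<tau> ^ length w)"
      using T2 T1 k \<tau> by (intro divide_left_mono) auto
    also have "\<dots> = 4 / k\<^sup>2 * \<tau> ^ length w" by simp
    also have "\<dots> \<le> max 2 (4 / k\<^sup>2) * \<tau> ^ length w"
      using \<tau> by (intro mult_right_mono) auto
    finally show ?thesis .
  qed
  note bound = this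
  show ?thesis
    unfolding dominated_def
  proof (intro exI conjI bexI allI impI)
    show "1 < max 2 (4 / k\<^sup>2)" by simp
  next
    show "\<tau> \<in> {0<..<1}" by (rule \<tau>)
  next
    fix n and w :: "(real ^ 2 ^ 2) list"
    assume "1 \<le> n" "length w = n \<and> set w \<subseteq> A"
    then have w: "set w \<subseteq> A" "w \<noteq> []" "length w = n" by auto
    show "singular_value (1 + 1) (foldr (**) w (mat 1)) / singular_value 1 (foldr (**) w (mat 1))
        \<le> max 2 (4 / k\<^sup>2) * \<tau> ^ n"
      using bound[OF w(1,2) refl] unfolding w(3) one_add_one .
  qed
qed

section \<open>Discontinuity\<close>

lemma matrix_square_if_trace_zero:
  fixes M :: "real ^ 2 ^ 2"
  assumes "trace M = 0"
  shows "M *v (M *v x) = (- det M) *\<^sub>R x"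
proof -
  have "M $ 2 $ 2 = - M $ 1 $ 1" using assms by (simp add: trace_2)
  then show ?thesis
    by (simp add: vec_eq_iff forall_2 matrix_vector_mult_def sum_2 det_2 algebra_simps)
qed

lemma foldr_comp_rotated:
  "foldr (\<circ>) (map (\<lambda>X. (*v) (rotation_mat \<theta> ** X)) w) id = (*v) (rot_prod \<theta> w)"
  by (induction w) (simp_all add: fun_eq_iff matrix_vector_mul_assoc)

text \<open>
  The word \<open>w w\<close> has as product a scalar matrix, by the Cayley-Hamilton theorem.
\<close>

lemma lower_spectral_radius_le_if_trace_zero:
  assumes w: "set w \<subseteq> A" "w \<noteq> []" and tr: "trace (rot_prod \<theta> w) = 0"
  shows "lower_spectral_radius UNIV ((*v) ` ((**) (rotation_mat \<theta>) ` A))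
           \<le> root (2 * length w) \<bar>det (rot_prod \<theta> w)\<bar>"
proof -
  let ?us = "map (\<lambda>X. (*v) (rotation_mat \<theta> ** X)) (w @ w)"
  have "foldr (\<circ>) ?us id = (\<lambda>x. (- det (rot_prod \<theta> w)) *\<^sub>R x)"
    unfolding foldr_comp_rotated rot_prod_append
    by (simp add: fun_eq_iff matrix_square_if_trace_zero[OF tr] flip: matrix_vector_mul_assoc)
  then have "onorm (foldr (\<circ>) ?us id) = onorm (\<lambda>x::real ^ 2. (- det (rot_prod \<theta> w)) *\<^sub>R x)"
    by (rule arg_cong)
  also have "\<dots> = \<bar>- det (rot_prod \<theta> w)\<bar> * onorm (\<lambda>x::real ^ 2. x)"
    by (rule onorm_scaleR[OF bounded_linear_ident])
  also have "\<dots> = \<bar>det (rot_prod \<theta> w)\<bar>" by (simp add: onorm_id)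
  finally have "onorm (foldr (\<circ>) ?us id) = \<bar>det (rot_prod \<theta> w)\<bar>" .
  moreover have "lower_spectral_radius UNIV ((*v) ` ((**) (rotation_mat \<theta>) ` A))
      \<le> root (length ?us) (onorm (foldr (\<circ>) ?us id))"
    by (rule lower_spectral_radius_le)
       (use w in \<open>auto simp: matrix_vector_mul_bounded_linear\<close>)
  ultimately show ?thesis by (simp add: mult_2)
qed

theorem theorem1:
  fixes A :: "(real ^ 2 ^ 2) set"
  assumes "A \<noteq> {}" and "compact A" and "A \<subseteq> GL2_plus"
    and "lower_spectral_radius UNIV ((*v) ` A) >
         sqrt (lower_spectral_radius (ext_power_space :: (real ^ (2 \<Rightarrow> 2)) set) (ext_power ` A))"
    and "\<not> dominated 1 A"
  shows "\<not> isCont (\<lambda>\<theta>. lower_spectral_radius UNIV ((*v) ` ((**) (rotation_mat \<theta>) ` A))) 0"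
proof
  define \<rho> where "\<rho> \<theta> = lower_spectral_radius UNIV ((*v) ` ((**) (rotation_mat \<theta>) ` A))" for \<theta>
  assume "isCont (\<lambda>\<theta>. lower_spectral_radius UNIV ((*v) ` ((**) (rotation_mat \<theta>) ` A))) 0"
  then have cont: "isCont \<rho> 0" by (simp add: \<rho>_def[abs_def])
  have "continuous_on A (det :: real ^ 2 ^ 2 \<Rightarrow> real)"
    unfolding det_2[abs_def] by (intro continuous_intros)
  then obtain B where B: "B \<in> A" "\<And>M. M \<in> A \<Longrightarrow> det B \<le> det M"
    using continuous_attains_inf[OF assms(2,1)] by blast
  define d where "d = det B"
  have d: "d > 0" using B(1) assms(3) by (auto simp: d_def GL2_plus_def)
  have "lower_spectral_radius (ext_power_space :: (real ^ (2 \<Rightarrow> 2)) set) (ext_power ` A) = d"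
    using lower_spectral_radius_ext_power[OF B(1) _ B(2)] d by (simp add: d_def)
  moreover have "\<rho> 0 = lower_spectral_radius UNIV ((*v) ` A)"
    by (simp add: \<rho>_def)
  ultimately have "sqrt d < \<rho> 0" using assms(4) by simp
  then obtain r where r: "sqrt d < r" "r < \<rho> 0" using dense by blast
  then have r0: "r > 0" using d by (meson less_trans real_sqrt_gt_zero)
  have "\<forall>\<^sub>F \<theta> in at 0. r < \<rho> \<theta>"
    using cont r(2) by (intro order_tendstoD(1)[of \<rho> "\<rho> 0"]) (auto simp: isCont_def)
  then obtain \<eta> where \<eta>: "\<eta> > 0" "\<And>\<theta>. \<theta> \<noteq> 0 \<Longrightarrow> \<bar>\<theta>\<bar> < \<eta> \<Longrightarrow> r < \<rho> \<theta>"
    by (auto simp: eventually_at dist_real_def)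
  have large: "r < \<rho> \<theta>" if "\<bar>\<theta>\<bar> < \<eta>" for \<theta>
    using \<eta>(2)[of \<theta>] that r(2) by (cases "\<theta> = 0") auto
  obtain P \<theta>0 where P: "set P \<subseteq> A" "P \<noteq> []" and \<theta>0: "\<bar>\<theta>0\<bar> < \<eta>"
    and ell: "(trace (rot_prod \<theta>0 P))\<^sup>2 \<le> det (rot_prod \<theta>0 P)"
    using dominated_if_no_elliptic_products[OF assms(3) \<eta>(1)] assms(5) by (meson not_le)
  have PG: "set P \<subseteq> GL2_plus" using P(1) assms(3) by blast
  obtain \<epsilon> c where \<epsilon>: "\<epsilon> > 0" and c: "c > 0" and fast:
    "\<And>\<theta> N w z. \<bar>\<theta> - \<theta>0\<bar> \<le> \<epsilon> \<Longrightarrow> set w \<subseteq> GL2_plus \<Longrightarrow>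
       N * c * (cmod (plane_act (rot_prod \<theta> (concat (replicate N P) @ w)) z))\<^sup>2
         \<le> turn \<theta> (concat (replicate N P) @ w) z"
    using elliptic_powers_turn[OF PG P(2) ell] by metis
  \<comment> \<open>Shrinking the interval keeps all its angles in the range where \<open>\<rho>\<close> exceeds \<open>r\<close>.\<close>
  define e where "e = min \<epsilon> ((\<eta> - \<bar>\<theta>0\<bar>) / 2)"
  have e: "e > 0" "e \<le> \<epsilon>" "\<bar>\<theta>0\<bar> + e < \<eta>" using \<epsilon> \<theta>0 by (auto simp: e_def min_def field_simps)
  obtain N :: nat where "N > 2 * pi / (c * (2 * e))" using reals_Archimedean2 by blast
  then have N: "N * c * (2 * e) \<ge> 2 * pi" using c e by (simp add: field_simps)
  define u where "u = concat (replicate N P)"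
  have u: "set u \<subseteq> A" using P(1) by (auto simp: u_def split: if_splits)
  define D where "D = prod_list (map det u)"
  \<comment> \<open>Comparing \<open>r\<close> with the growth along \<open>u B\<^sup>m\<close>, where \<open>u\<close> does not depend on \<open>m\<close>.\<close>
  have bound: "(r\<^sup>2) ^ length u * (r\<^sup>2 / d) ^ m \<le> D" if m: "m > 0" for m
  proof -
    define w where "w = u @ replicate m B"
    have w: "set w \<subseteq> A" "w \<noteq> []" using u B(1) m by (auto simp: w_def)
    have wG: "set w \<subseteq> GL2_plus" using w assms(3) by blast
    have "\<exists>\<theta>\<in>{\<theta>0 - e..\<theta>0 + e}. trace (rot_prod \<theta> w) = 0"
    proof (rule turning_trace_zero[OF wG, where c = "N * c"])
      show "2 * pi \<le> N * c * (\<theta>0 + e - (\<theta>0 - e))" using N by (simp add: algebra_simps)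
      show "N * c * (cmod (plane_act (rot_prod \<theta> w) 1))\<^sup>2 \<le> turn \<theta> w 1"
        if "\<theta> \<in> {\<theta>0 - e..\<theta>0 + e}" for \<theta>
        unfolding w_def u_def
        by (rule fast) (use that e wG in \<open>auto simp: w_def abs_le_iff\<close>)
    qed (use e in auto)
    then obtain \<theta> where \<theta>: "\<theta> \<in> {\<theta>0 - e..\<theta>0 + e}" "trace (rot_prod \<theta> w) = 0" by blast
    then have "\<bar>\<theta>\<bar> < \<eta>" using e(3) unfolding atLeastAtMost_iff by linarith
    then have "r < \<rho> \<theta>" by (rule large)
    also have "\<dots> \<le> root (2 * length w) \<bar>det (rot_prod \<theta> w)\<bar>"
      unfolding \<rho>_def by (rule lower_spectral_radius_le_if_trace_zero[OF w \<theta>(2)])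
    also have "\<bar>det (rot_prod \<theta> w)\<bar> = det (rot_prod \<theta> w)"
      using det_rot_prod_pos[OF wG, of \<theta>] by simp
    also have "det (rot_prod \<theta> w) = D * d ^ m"
      by (simp add: det_rot_prod w_def D_def d_def)
    finally have "r < root (2 * length w) (D * d ^ m)" .
    then have "r ^ (2 * length w) \<le> D * d ^ m"
      using w(2) r0 det_rot_prod_pos[OF wG, of \<theta>] \<open>det (rot_prod \<theta> w) = D * d ^ m\<close>
        power_mono[of r "root (2 * length w) (D * d ^ m)" "2 * length w"]
      by (simp add: real_root_pow_pos2)
    then have "(r\<^sup>2) ^ length u * (r\<^sup>2) ^ m \<le> D * d ^ m"
      by (simp add: w_def power_mult power_add)
    then show ?thesis using d by (simp add: power_divide field_simps)
  qed
  have "d < r\<^sup>2" using r(1) r0 by (metis less_le real_sqrt_less_iff real_sqrt_unique)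
  then have "r\<^sup>2 / d > 1" using d by simp
  then obtain m where m: "(r\<^sup>2 / d) ^ m > D / (r\<^sup>2) ^ length u"
    using real_arch_pow by blast
  then have "D < (r\<^sup>2) ^ length u * (r\<^sup>2 / d) ^ m"
    using r0 by (simp add: pos_divide_less_eq mult.commute)
  also have "\<dots> \<le> (r\<^sup>2) ^ length u * (r\<^sup>2 / d) ^ Suc m"
    using \<open>r\<^sup>2 / d > 1\<close> by (intro mult_left_mono power_increasing) auto
  finally have "D < (r\<^sup>2) ^ length u * (r\<^sup>2 / d) ^ Suc m" .
  with bound[of "Suc m"] show False by simp
qed

end
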